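(* Let $\mu$ be a strong weight generator, $(a_n)_{n\in\mathbb{N}}$ a strictly increasing real sequence with $a_n<0$ for all $n\in\mathbb{N}$ or $a_n\ge0$ for all $n\in\mathbb{N}$, and with $\lim_{n\to\infty}a_n=0$ or $\lim_{n\to\infty}a_n=\infty$. Let $\mathcal{V}:=(\nu_n)_{n\in\mathbb{N}}$ with $\nu_n:=\exp(a_n\mu)$ and $\Omega_n:=S_n:=\{z\in\mathbb{C} : |\operatorname{Im}(z)|<n\}$ for all $n\in\mathbb{N}$ (so $\Omega=\mathbb{C}$). If Condition (D) (see context) with $I_{214}(n)\ge I_{14}(n+1)$ for all $n\in\mathbb{N}$ and $(\omega.1)$ (see context) are fulfilled, then $\mathcal{OV}(\mathbb{C})$ satisfies property $(\Omega)$.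
   Context: $\mathbb{N}=\{1,2,\dots\}$, $\mathbb{R}^2$ is identified with $\mathbb{C}$. $|\cdot|$ is the Euclidean norm, $\|\cdot\|_\infty$ the sup-norm on $\mathbb{R}^2$, $\mathbb{B}_r(x)$ the open Euclidean ball; $\mathrm{d}^{\|\cdot\|}(M_0,M_1)=\inf_{x\in M_0,y\in M_1}\|x-y\|$ for non-empty sets, and $\infty$ if one of them is empty; $M^C=\mathbb{R}^2\setminus M$. **Strong weight generator.** A continuous function $\mu\colon\mathbb{C}\to[0,\infty)$ is a strong weight generator if $\mu(z)=\mu(|\operatorname{Re}(z)|)$ for all $z\in\mathbb{C}$, $\mu_{\mid[0,\infty)}$ is strictly increasing, $\lim_{x\to\infty,\,x\in\mathbb{R}}\frac{\ln(1+|x|)}{\mu(x)}=0$, and $\exists\,\Gamma>1\ \forall n\in\mathbb{N}\ \exists\,C>0\ \forall x\in[0,\infty):\ \mu(x+n)\le\Gamma\mu(x)+C$. **Space.** $\mathcal{OV}(\mathbb{C})$ is the space of entire functions $f$ with $|f|_n:=\sup_{z\in\Omega_n}|f(z)|\nu_n(z)<\infty$ for all $n\in\mathbb{N}$, a Fréchet space with the seminorms $(|\cdot|_n)_{n\in\mathbb{N}}$. **$(\omega.1)$.** For every $k\in\mathbb{N}$ there is $\rho_k\in\mathbb{R}$ with $0<\rho_k<\mathrm{d}^{\|\cdot\|_\infty}(\{x\},\partial\Omega_{k+1})$ for all $x\in\Omega_k$ such that for any $n\in\mathbb{N}$ there are a natural number $J_1(n)\ge n$ and $C_1(n)>0$ such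 that for all $x\in\Omega_k$: $\sup_{\|\zeta\|_\infty\le\rho_k}\nu_n(x+\zeta)\le C_1(n)\inf_{\|\zeta\|_\infty\le\rho_k}\nu_{J_1(n)}(x+\zeta)$. **Condition (D).** $\Omega_n\neq\mathbb{R}^2$ and $\Omega_n\subset\Omega_{n+1}$ for all $n$, $\mathrm{d}^{|\cdot|}(\Omega_n,\partial\Omega_k)>0$ for all $k>n$, $\bigcup_n\Omega_n=\Omega$, and: a) For every $n\in\mathbb{N}$ there are an entire function $g_n$ with $g_n(0)=1$ and natural numbers $I_1(n),I_2(n)>n$ such that (i) for every $\varepsilon>0$ there is a compact set $K\subset\overline{\Omega}_n$ with $\nu_n(x)\le\varepsilon\nu_{I_1(n)}(x)$ for all $x\in\Omega_n\setminus K$; (ii) there is an open set $X_{I_2(n)}\subset\mathbb{R}^2\setminus\overline{\Omega}_{I_2(n)}$ and, with $\mathrm{d}_{X,I_2(n)}:=\mathrm{d}^{|\cdot|}(X_{I_2(n)},\Omega_{I_2(n)})$, there are $R_n,r_n\in\mathbb{R}$ with $0<2R_n<\mathrm{d}_{X,I_2(n)}$ and $R_n<r_n<\mathrm{d}_{X,I_2(n)}-R_n$, and a function $A_2(\cdot,n)\colon X_{I_2(n)}+\mathbb{B}_{R_n}(0)\to(0,\infty)$ whose restriction to $X_{I_2(n)}$ is locally bounded, such that $\max\{|g_n(\zeta)|\nu_{I_2(n)}(z) : \zeta\in\mathbb{R}^2,\ |\zeta-(z-x)|=r_n\}\le A_2(x,n)$ for all $z\in\Omega_{I_2(n)}$ and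 $x\in X_{I_2(n)}+\mathbb{B}_{R_n}(0)$; (iii) for every compact $K\subset\mathbb{R}^2$ there is $A_3(n,K)>0$ with $\int_K\frac{|g_n(x-y)|\nu_n(x)}{|x-y|}\,dy\le A_3(n,K)$ for all $x\in\Omega_n$. b) For every $n\in\mathbb{N}$ there are a natural number $I_4(n)>n$ and $A_4(n)>0$ such that, with $I_{14}(n):=I_1(I_4(n))$, $\int_{\Omega_{I_4(n)}}\frac{|g_{I_{14}(n)}(x-y)|\nu_p(x)}{|x-y|\nu_k(y)}\,dy\le A_4(n)$ for all $x\in\Omega_p$, for $(k,p)=(I_4(n),n)$ and for $(k,p)=(I_{14}(n),I_{14}(n))$. c) With $I_{214}(n):=I_2(I_{14}(n))$: for every $n\in\mathbb{N}$, every closed $M\subset\overline{\Omega}_n$ and every connected component $N$ of $M^C$, if $N\cap\overline{\Omega}_n^{\,C}\ne\varnothing$ then $N\cap X_{I_{214}(n)}\neq\varnothing$ (where $X_{I_{214}(n)}$ is the set from a)(ii) for the index $I_{14}(n)$). **Property $(\Omega)$.** A Fréchet space $F$ with increasing fundamental system of seminorms $(\|\cdot\|_k)_{k\in\mathbb{N}}$ and $U_k:=\{x\in F:\|x\|_k\le1\}$ satisfies $(\Omega)$ if $\forall p\,\exists q\,\forall k\,\exists n\in\mathbb{N},C>0\,\forall r>0:\ U_q\subset Cr^nU_k+\frac1rU_p$. *)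

theory Defs
  imports
    "HOL-Complex_Analysis.Complex_Analysis"
    "HOL-Library.Function_Algebras"
    "HOL-Library.Set_Algebras"
begin

text \<open>
  The plane is the type \<^typ>\<open>complex\<close>: \<^const>\<open>norm\<close> is the Euclidean norm and
  \<^const>\<open>infnorm\<close> the sup-norm of real and imaginary part. The natural numbers
  start at 1, hence the bounds \<open>n \<ge> 1\<close>; families are indexed by \<^typ>\<open>nat\<close> and
  their value at 0 is never used.
\<close>

text \<open>
  Extended-real valued, because the distance to the empty set is \<open>\<infinity>\<close>
  (whereas \<^const>\<open>setdist\<close> is 0 there).
\<close>

definition edist_sets :: "(complex \<Rightarrow> real) \<Rightarrow> complex set \<Rightarrow> complex set \<Rightarrow> ereal" where
  "edist_sets N M\<^sub>0 M\<^sub>1 = (INF (x, y) \<in> M\<^sub>0 \<times> M\<^sub>1. ereal (N (x - y)))"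

definition strong_weight_generator :: "(complex \<Rightarrow> real) \<Rightarrow> bool" where
  "strong_weight_generator \<mu> \<longleftrightarrow>
     continuous_on UNIV \<mu> \<and>
     (\<forall>z. 0 \<le> \<mu> z) \<and>
     (\<forall>z. \<mu> z = \<mu> (complex_of_real \<bar>Re z\<bar>)) \<and>
     strict_mono_on {0..} (\<lambda>x::real. \<mu> (complex_of_real x)) \<and>
     ((\<lambda>x::real. ln (1 + \<bar>x\<bar>) / \<mu> (complex_of_real x)) \<longlongrightarrow> 0) at_top \<and>
     (\<exists>\<Gamma>>1. \<forall>n::nat. n \<ge> 1 \<longrightarrow> (\<exists>C>0. \<forall>x::real. x \<ge> 0 \<longrightarrow>
        \<mu> (complex_of_real (x + real n)) \<le> \<Gamma> * \<mu> (complex_of_real x) + C))"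

definition strip :: "nat \<Rightarrow> complex set" where
  "strip n = {z. \<bar>Im z\<bar> < real n}"

definition weighted_sup :: "(nat \<Rightarrow> complex set) \<Rightarrow> (nat \<Rightarrow> complex \<Rightarrow> real) \<Rightarrow> nat \<Rightarrow>
    (complex \<Rightarrow> complex) \<Rightarrow> real" where
  "weighted_sup \<Omega> \<nu> n f = (SUP z\<in>\<Omega> n. norm (f z) * \<nu> n z)"

definition OV :: "(nat \<Rightarrow> complex set) \<Rightarrow> (nat \<Rightarrow> complex \<Rightarrow> real) \<Rightarrow> (complex \<Rightarrow> complex) set" where
  "OV \<Omega> \<nu> = {f. f holomorphic_on UNIV \<and>
     (\<forall>n\<ge>1. bdd_above ((\<lambda>z. norm (f z) * \<nu> n z) ` \<Omega> n))}"

definition condition_omega1 :: "(nat \<Rightarrow> complex set) \<Rightarrow> (nat \<Rightarrow> complex \<Rightarrow> real) \<Rightarrow> bool" where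
  "condition_omega1 \<Omega> \<nu> \<longleftrightarrow>
     (\<forall>k\<ge>1. \<exists>\<rho>>0.
        (\<forall>x\<in>\<Omega> k. ereal \<rho> < edist_sets infnorm {x} (frontier (\<Omega> (k + 1)))) \<and>
        (\<forall>n\<ge>1. \<exists>J\<ge>n. \<exists>C>0. \<forall>x\<in>\<Omega> k.
           (SUP \<zeta>\<in>{\<zeta>. infnorm \<zeta> \<le> \<rho>}. ereal (\<nu> n (x + \<zeta>)))
             \<le> ereal C * (INF \<zeta>\<in>{\<zeta>. infnorm \<zeta> \<le> \<rho>}. ereal (\<nu> J (x + \<zeta>)))))"

text \<open>
  In Condition (D) the objects \<open>g\<close>, \<open>I\<^sub>1\<close>, \<open>I\<^sub>2\<close>, \<open>I\<^sub>4\<close> and \<open>X\<close> are shared between the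
  clauses and therefore are parameters. \<open>X n\<close> is the open set chosen for the index \<open>n\<close> in
  clause (a)(ii), which is usually denoted by \<open>X\<close> with subscript \<open>I\<^sub>2 n\<close>; thus the set denoted
  with the subscript \<open>I\<^sub>2 (I\<^sub>1 (I\<^sub>4 n))\<close> is \<open>X (I\<^sub>1 (I\<^sub>4 n))\<close>.
  The integrals are nonnegative Lebesgue integrals with values in \<^typ>\<open>ennreal\<close>, so that the
  bounds include integrability.
\<close>

definition exhaustion_D :: "complex set \<Rightarrow> (nat \<Rightarrow> complex set) \<Rightarrow> bool" where
  "exhaustion_D G \<Omega> \<longleftrightarrow>
     (\<forall>n\<ge>1. \<Omega> n \<noteq> UNIV \<and> \<Omega> n \<subseteq> \<Omega> (n + 1)) \<and>
     (\<forall>n\<ge>1. \<forall>k>n. edist_sets norm (\<Omega> n) (frontier (\<Omega> k)) > 0) \<and>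
     (\<Union>n\<in>{1..}. \<Omega> n) = G"

definition condition_D_a_ii :: "complex set \<Rightarrow> (complex \<Rightarrow> real) \<Rightarrow> (complex \<Rightarrow> complex) \<Rightarrow>
    complex set \<Rightarrow> bool" where
  "condition_D_a_ii W w h Y \<longleftrightarrow>
     open Y \<and> Y \<subseteq> - closure W \<and>
     (\<exists>R r. 0 < 2 * R \<and> ereal (2 * R) < edist_sets norm Y W \<and>
        R < r \<and> ereal r < edist_sets norm Y W - ereal R \<and>
        (\<exists>A\<^sub>2 :: complex \<Rightarrow> real.
           (\<forall>x \<in> Y + ball 0 R. A\<^sub>2 x > 0) \<and>
           (\<forall>x\<in>Y. \<exists>e>0. bounded (A\<^sub>2 ` (Y \<inter> ball x e))) \<and>
           (\<forall>z\<in>W. \<forall>x \<in> Y + ball 0 R. \<forall>\<zeta>. norm (\<zeta> - (z - x)) = r \<longrightarrow>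
              norm (h \<zeta>) * w z \<le> A\<^sub>2 x)))"

definition condition_D_a :: "(nat \<Rightarrow> complex set) \<Rightarrow> (nat \<Rightarrow> complex \<Rightarrow> real) \<Rightarrow>
    (nat \<Rightarrow> complex \<Rightarrow> complex) \<Rightarrow> (nat \<Rightarrow> nat) \<Rightarrow> (nat \<Rightarrow> nat) \<Rightarrow> (nat \<Rightarrow> complex set) \<Rightarrow> bool" where
  "condition_D_a \<Omega> \<nu> g I\<^sub>1 I\<^sub>2 X \<longleftrightarrow>
     (\<forall>n\<ge>1.
        g n holomorphic_on UNIV \<and> g n 0 = 1 \<and> I\<^sub>1 n > n \<and> I\<^sub>2 n > n \<and>
        (\<forall>\<epsilon>>0. \<exists>K. compact K \<and> K \<subseteq> closure (\<Omega> n) \<and>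
           (\<forall>x \<in> \<Omega> n - K. \<nu> n x \<le> \<epsilon> * \<nu> (I\<^sub>1 n) x)) \<and>
        condition_D_a_ii (\<Omega> (I\<^sub>2 n)) (\<nu> (I\<^sub>2 n)) (g n) (X n) \<and>
        (\<forall>K. compact K \<longrightarrow> (\<exists>A\<^sub>3>0. \<forall>x\<in>\<Omega> n.
           (\<integral>\<^sup>+y\<in>K. ennreal (norm (g n (x - y)) * \<nu> n x / norm (x - y)) \<partial>lborel) \<le> ennreal A\<^sub>3)))"

definition condition_D_b :: "(nat \<Rightarrow> complex set) \<Rightarrow> (nat \<Rightarrow> complex \<Rightarrow> real) \<Rightarrow>
    (nat \<Rightarrow> complex \<Rightarrow> complex) \<Rightarrow> (nat \<Rightarrow> nat) \<Rightarrow> (nat \<Rightarrow> nat) \<Rightarrow> bool" where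
  "condition_D_b \<Omega> \<nu> g I\<^sub>1 I\<^sub>4 \<longleftrightarrow>
     (\<forall>n\<ge>1. I\<^sub>4 n > n \<and>
        (\<exists>A\<^sub>4>0. \<forall>(k, p) \<in> {(I\<^sub>4 n, n), (I\<^sub>1 (I\<^sub>4 n), I\<^sub>1 (I\<^sub>4 n))}. \<forall>x\<in>\<Omega> p.
           (\<integral>\<^sup>+y\<in>\<Omega> (I\<^sub>4 n). ennreal (norm (g (I\<^sub>1 (I\<^sub>4 n)) (x - y)) * \<nu> p x / (norm (x - y) * \<nu> k y))
              \<partial>lborel) \<le> ennreal A\<^sub>4))"

definition condition_D_c :: "(nat \<Rightarrow> complex set) \<Rightarrow> (nat \<Rightarrow> nat) \<Rightarrow> (nat \<Rightarrow> nat) \<Rightarrow>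
    (nat \<Rightarrow> complex set) \<Rightarrow> bool" where
  "condition_D_c \<Omega> I\<^sub>1 I\<^sub>4 X \<longleftrightarrow>
     (\<forall>n\<ge>1. \<forall>M. closed M \<and> M \<subseteq> closure (\<Omega> n) \<longrightarrow>
        (\<forall>N \<in> components (- M). N \<inter> - closure (\<Omega> n) \<noteq> {} \<longrightarrow> N \<inter> X (I\<^sub>1 (I\<^sub>4 n)) \<noteq> {}))"

definition condition_D :: "complex set \<Rightarrow> (nat \<Rightarrow> complex set) \<Rightarrow> (nat \<Rightarrow> complex \<Rightarrow> real) \<Rightarrow>
    (nat \<Rightarrow> complex \<Rightarrow> complex) \<Rightarrow> (nat \<Rightarrow> nat) \<Rightarrow> (nat \<Rightarrow> nat) \<Rightarrow> (nat \<Rightarrow> nat) \<Rightarrow>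
    (nat \<Rightarrow> complex set) \<Rightarrow> bool" where
  "condition_D G \<Omega> \<nu> g I\<^sub>1 I\<^sub>2 I\<^sub>4 X \<longleftrightarrow>
     exhaustion_D G \<Omega> \<and>
     condition_D_a \<Omega> \<nu> g I\<^sub>1 I\<^sub>2 X \<and>
     condition_D_b \<Omega> \<nu> g I\<^sub>1 I\<^sub>4 \<and>
     condition_D_c \<Omega> I\<^sub>1 I\<^sub>4 X"

text \<open>
  Property \<open>(\<Omega>)\<close> of a space with carrier \<open>F\<close>, scalar multiplication \<open>smul\<close> and fundamental
  system of seminorms \<open>s\<close>; the sum of the two scaled unit balls is the Minkowski sum.
\<close>

definition seminorm_ball :: "'b set \<Rightarrow> (nat \<Rightarrow> 'b \<Rightarrow> real) \<Rightarrow> nat \<Rightarrow> 'b set" where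
  "seminorm_ball F s k = {x \<in> F. s k x \<le> 1}"

definition property_Omega :: "(real \<Rightarrow> 'b \<Rightarrow> 'b) \<Rightarrow> 'b::ab_group_add set \<Rightarrow>
    (nat \<Rightarrow> 'b \<Rightarrow> real) \<Rightarrow> bool" where
  "property_Omega smul F s \<longleftrightarrow>
     (\<forall>p\<ge>1. \<exists>q\<ge>1. \<forall>k\<ge>1. \<exists>n::nat. n \<ge> 1 \<and> (\<exists>C>0. \<forall>r>0.
        seminorm_ball F s q \<subseteq>
          smul (C * r ^ n) ` seminorm_ball F s k + smul (1 / r) ` seminorm_ball F s p))"

text \<open>Addition of functions is the pointwise one of \<^theory>\<open>HOL-Library.Function_Algebras\<close>.\<close>

definition pointwise_scale :: "real \<Rightarrow> (complex \<Rightarrow> complex) \<Rightarrow> (complex \<Rightarrow> complex)" where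
  "pointwise_scale c f = (\<lambda>z. complex_of_real c * f z)"

end

theory Submission
  imports Defs
begin

text \<open>
  Write \<open>M\<close> for the restriction of \<open>\<mu>\<close> to the real line, so that \<open>\<mu> z = M (Re z)\<close>, and let \<open>f\<close> be in
  the unit ball for \<open>q = p + 1\<close>, that is, \<open>|f z| \<le> exp (- a q * M (Re z))\<close> on the strip \<open>|Im z| < q\<close>.

  The weight grows at most linearly. With \<open>m = I\<^sub>1 (I\<^sub>4 1)\<close>, the instance of clause (b) of
  Condition (D) in which both weights have the index \<open>m\<close> bounds the integral of
  \<open>|g m (x - y)| / |x - y|\<close> against \<open>exp (a m * (M (Re x) - M (Re y)))\<close> uniformly in \<open>x\<close>. As \<open>g m 0 = 1\<close>,
  the kernel is bounded below near the diagonal, so the increments of \<open>M\<close> over some fixed step are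
  bounded. Therefore a Gaussian absorbs every factor \<open>exp (b * (M x - M t))\<close> up to a constant
  multiple of the integrable function \<open>1 / (1 + (t - x)\<^sup>2)\<close> (\<open>gaussian_absorbs_linear_growth\<close>).

  The splitting is read off from Cauchy's formula with Gaussian weight on the two lines
  \<open>Im \<zeta> = h\<close> and \<open>Im \<zeta> = - h\<close> with \<open>h = p + 1/2\<close>, which are at distance \<open>1/2\<close> from the strip \<open>|Im z| < p\<close>:
  \<open>2 \<pi> \<i> f z\<close> is the difference of the integrals of \<open>f \<zeta> * exp (- (\<zeta> - z)\<^sup>2) / (\<zeta> - z)\<close>
  over the lower and the upper line. Two changes turn this into an entire function of \<open>z\<close>. The
  lines are cut off at \<open>|Re \<zeta>| = X\<close>, and \<open>1 / (\<zeta> - z)\<close> is replaced by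
  \<open>(1 - exp (\<i> \<tau> (\<zeta> - z))) / (\<zeta> - z)\<close>, which has no pole; it is the truncation at the frequency \<open>\<tau>\<close>
  of the Fourier integral that represents the Cauchy kernel in a half-plane. The choice of
  \<open>\<tau> = T\<close> on the upper and \<open>\<tau> = - T\<close> on the lower line makes the added exponential at most
  \<open>exp (- T / 2)\<close> on the strip \<open>|Im z| < p\<close>.

  Choose \<open>T = 2 * ln r\<close> and \<open>M X = M 0 + ln r / (a q - a p)\<close>. Then on the strip \<open>|Im z| < p\<close> the
  added exponential contributes a factor \<open>1/r\<close> to the error, and so does the cut-off, because
  \<open>exp (- a q * M t) \<le> (1/r) * exp (- a p * M t)\<close> for \<open>|t| \<ge> X\<close> (\<open>entire_part_error\<close>). On a strip
  \<open>|Im z| < k\<close>, on the other hand, the exponential is at most \<open>exp (T (h + k))\<close> and the change of weight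
  at most \<open>exp (|a k - a q| * M X)\<close> on the cut-off lines, and both are powers of \<open>r\<close> up to a constant
  (\<open>entire_part_growth\<close>). As this holds for all \<open>k\<close> simultaneously, the entire part lies in the
  space, and the inclusion required by \<open>(\<Omega>)\<close> follows.
\<close>

section \<open>Linear growth of the weight\<close>

text \<open>
  Bounded increments over a fixed step add up linearly. The step bound is available only from \<open>h\<close>
  on, so the path from \<open>y\<close> to \<open>y + u\<close> first moves to \<open>y + h\<close>; monotonicity pays for this move.
\<close>

lemma increment_bound_imp_linear_growth:
  fixes M :: "real \<Rightarrow> real"
  assumes even: "\<And>x. M x = M \<bar>x\<bar>"
    and mono: "\<And>x y. 0 \<le> x \<Longrightarrow> x \<le> y \<Longrightarrow> M x \<le> M y"
    and h: "0 < h" and step: "\<And>x. h \<le> x \<Longrightarrow> M (x + h) \<le> M x + C"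
  shows "\<exists>L>0. \<forall>x t. M x \<le> M t + L * (1 + \<bar>x - t\<bar>)"
proof -
  have C: "0 \<le> C"
    using step[of h] mono[of h "h + h"] h by simp
  have iter: "M (x + real j * h) \<le> M x + real j * C" if "h \<le> x" for x j
  proof (induction j)
    case (Suc j)
    have "M (x + real j * h + h) \<le> M (x + real j * h) + C"
      using that h by (intro step) (simp add: add_increasing2)
    with Suc show ?case by (simp add: algebra_simps)
  qed simp
  define D where "D = C + (M (2 * h) - M 0)"
  define L where "L = D + C + C / h + 1"
  have D: "C \<le> D"
    unfolding D_def using mono[of 0 "2 * h"] h by simp
  have first: "M (y + h) \<le> M y + D" if "0 \<le> y" for y
  proof (cases "h \<le> y")
    case True
    then show ?thesis using step[of y] D by simp
  next
    case False
    have "M (y + h) \<le> M (2 * h)" using that h False by (intro mono) auto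
    moreover have "M 0 \<le> M y" using that by (intro mono) auto
    ultimately show ?thesis unfolding D_def using C by simp
  qed
  have pos: "M (y + u) \<le> M y + L * (1 + u)" if "0 \<le> y" "0 \<le> u" for y u
  proof -
    define j where "j = nat \<lceil>u / h\<rceil>"
    have "0 \<le> u / h" using that h by simp
    then have j: "u / h \<le> real j" "real j \<le> u / h + 1"
      unfolding j_def by linarith+
    have "u \<le> real j * h" using j(1) h by (simp add: field_simps)
    then have "M (y + u) \<le> M (y + h + real j * h)"
      using that h by (intro mono) auto
    also have "\<dots> \<le> M (y + h) + real j * C"
      using that by (intro iter) simp
    also have "\<dots> \<le> M y + D + (u / h + 1) * C"
      using first[OF that(1)] mult_right_mono[OF j(2) C] by simp
    also have "\<dots> \<le> M y + L * (1 + u)"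
    proof -
      have "0 \<le> D * u" "0 \<le> C * u" "0 \<le> C / h" "0 \<le> u"
        using C D that h by auto
      then show ?thesis unfolding L_def by (simp add: algebra_simps add_divide_distrib)
    qed
    finally show ?thesis .
  qed
  have "M x \<le> M t + L * (1 + \<bar>x - t\<bar>)" for x t
  proof -
    have "M x = M \<bar>x\<bar>" by (rule even)
    also have "\<dots> \<le> M (\<bar>t\<bar> + \<bar>x - t\<bar>)" by (intro mono) auto
    also have "\<dots> \<le> M \<bar>t\<bar> + L * (1 + \<bar>x - t\<bar>)" by (intro pos) auto
    also have "M \<bar>t\<bar> = M t" by (rule even[symmetric])
    finally show ?thesis .
  qed
  moreover have "0 < L" unfolding L_def using C D h by (simp add: add_nonneg_pos)
  ultimately show ?thesis by blast
qed

text \<open>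
  In a box of fixed size at distance \<open>h\<close> from \<open>x\<close>, the kernel \<open>G (x - y) / (x - y)\<close> is bounded away
  from \<open>0\<close>, so the integral bound controls the infimum of \<open>exp (c * (M x - M (Re y)))\<close> over that box.
  The box lies on the left of the centre if \<open>c > 0\<close> and on the right if \<open>c < 0\<close>, so
  that the exponent is the increment of \<open>M\<close> with a positive factor.
\<close>

lemma cauchy_kernel_bound_imp_increment_bound:
  fixes M :: "real \<Rightarrow> real" and G :: "complex \<Rightarrow> complex"
  assumes mono: "\<And>x y. 0 \<le> x \<Longrightarrow> x \<le> y \<Longrightarrow> M x \<le> M y"
    and G: "isCont G 0" "G 0 = 1"
    and c: "c \<noteq> 0" and A: "0 < A"
    and S: "{z. \<bar>Im z\<bar> < 1} \<subseteq> S"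
    and bound: "\<And>x::real. (\<integral>\<^sup>+y\<in>S. ennreal (norm (G (of_real x - y)) * exp (c * M x)
                    / (norm (of_real x - y) * exp (c * M (Re y)))) \<partial>lborel) \<le> ennreal A"
  shows "\<exists>h>0. \<exists>C. \<forall>x\<ge>h. M (x + h) \<le> M x + C"
proof -
  have "\<forall>\<^sub>F w in nhds 0. dist (G w) (G 0) < 1 / 2"
    using G(1) by (intro tendstoD) (auto simp: continuous_at tendsto_at_iff_tendsto_nhds)
  then obtain e where e: "0 < e" "\<And>w. dist w 0 < e \<Longrightarrow> dist (G w) (G 0) < 1 / 2"
    unfolding eventually_nhds_metric by blast
  \<comment> \<open>All points of the boxes below have distance less than \<open>4 * h\<close> from the centre, which keeps
    \<open>x - y\<close> in the disc of radius \<open>e\<close>; \<open>h < 1\<close> keeps the boxes in \<open>S\<close>.\<close>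
  define h where "h = min e 1 / 4"
  have h: "0 < h" "h < 1" "4 * h \<le> e" using e(1) by (auto simp: h_def)
  have G_ge: "1 / 2 \<le> norm (G w)" if "norm w < 4 * h" for w
  proof -
    have "norm (G w - 1) < 1 / 2"
      using e(2)[of w] that h G(2) by (simp add: dist_norm)
    then show ?thesis using norm_triangle_ineq2[of 1 "1 - G w"] by (simp add: norm_minus_commute)
  qed
  have box: "exp E * h / 8 \<le> A"
    if dist: "\<And>t. t \<in> {s..s + h} \<Longrightarrow> h \<le> \<bar>x - t\<bar> \<and> \<bar>x - t\<bar> \<le> 2 * h"
      and E: "\<And>t. t \<in> {s..s + h} \<Longrightarrow> E \<le> c * (M x - M t)" for x s E
  proof -
    define B where "B = cbox (Complex s (- h / 2)) (Complex (s + h) (h / 2))"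
    have ptw: "ennreal (exp E / (8 * h)) * indicator B y \<le>
        ennreal (norm (G (of_real x - y)) * exp (c * M x)
          / (norm (of_real x - y) * exp (c * M (Re y)))) * indicator S y" for y
    proof (cases "y \<in> B")
      case True
      then have y: "Re y \<in> {s..s + h}" "\<bar>Im y\<bar> \<le> h / 2"
        by (auto simp: B_def in_cbox_complex_iff)
      have "\<bar>Im y\<bar> < 1" using y(2) h by linarith
      then have yS: "y \<in> S" using S by auto
      have "norm (of_real x - y) \<le> \<bar>x - Re y\<bar> + \<bar>Im y\<bar>"
        using cmod_le[of "of_real x - y"] by simp
      then have le: "norm (of_real x - y) < 4 * h"
        using dist[OF y(1)] y(2) h(1) by linarith
      have "\<bar>x - Re y\<bar> \<le> norm (of_real x - y)"
        using abs_Re_le_cmod[of "of_real x - y"] by simp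
      then have pos: "0 < norm (of_real x - y)"
        using dist[OF y(1)] h(1) by linarith
      have "exp E / (8 * h) = (1 / 2) * exp E / (4 * h)" by simp
      also have "\<dots> \<le> norm (G (of_real x - y)) * exp (c * (M x - M (Re y))) / norm (of_real x - y)"
        using G_ge[OF le] E[OF y(1)] le pos by (intro frac_le mult_mono) auto
      also have "\<dots> = norm (G (of_real x - y)) * exp (c * M x)
          / (norm (of_real x - y) * exp (c * M (Re y)))"
        by (simp add: right_diff_distrib exp_diff)
      finally show ?thesis using True yS by (simp add: ennreal_leI)
    qed (simp add: B_def)
    have "emeasure lborel B = ennreal (h * h)"
      unfolding B_def using h(1)
      by (subst emeasure_lborel_cbox) (auto simp: Basis_complex_def)
    then have "(\<integral>\<^sup>+y. ennreal (exp E / (8 * h)) * indicator B y \<partial>lborel)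
        = ennreal (exp E / (8 * h)) * ennreal (h * h)"
      by (subst nn_integral_cmult_indicator) (auto simp: B_def)
    also have "\<dots> = ennreal (exp E * h / 8)"
      using h(1) by (simp add: ennreal_mult[symmetric])
    finally have "ennreal (exp E * h / 8) \<le> ennreal A"
      using nn_integral_mono[OF ptw] bound[of x] order_trans by fastforce
    then show ?thesis using A by (simp add: ennreal_le_iff)
  qed
  define C where "C = ln (8 * A / h) / \<bar>c\<bar>"
  have "M (x + h) \<le> M x + C" if x: "h \<le> x" for x
  proof -
    have "exp (\<bar>c\<bar> * (M (x + h) - M x)) * h / 8 \<le> A"
    proof (cases "0 < c")
      case True
      show ?thesis
      proof (rule box[where x = "x + h" and s = "x - h"])
        fix t assume t: "t \<in> {x - h..x - h + h}"
        then have "M t \<le> M x" using x by (intro mono) auto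
        then show "\<bar>c\<bar> * (M (x + h) - M x) \<le> c * (M (x + h) - M t)"
          using True by (auto intro!: mult_left_mono)
      qed (use h(1) in auto)
    next
      case False
      show ?thesis
      proof (rule box[where x = x and s = "x + h"])
        fix t assume t: "t \<in> {x + h..x + h + h}"
        then have "M (x + h) \<le> M t" using x h(1) by (intro mono) auto
        then show "\<bar>c\<bar> * (M (x + h) - M x) \<le> c * (M x - M t)"
          using False mult_left_mono[of "M (x + h) - M x" "M t - M x" "- c"]
          by (simp add: algebra_simps)
      qed (use h(1) in auto)
    qed
    then have "exp (\<bar>c\<bar> * (M (x + h) - M x)) \<le> 8 * A / h"
      using h(1) by (simp add: field_simps)
    then have "\<bar>c\<bar> * (M (x + h) - M x) \<le> ln (8 * A / h)"
      using A h(1) by (subst ln_ge_iff) auto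
    then show ?thesis unfolding C_def using c by (simp add: field_simps)
  qed
  then show ?thesis using h(1) by blast
qed


section \<open>The Gaussian against weights of linear growth\<close>

text \<open>
  Changing the weight from \<open>M t\<close> to \<open>M x\<close> costs at most \<open>exp (B * (1 + |t - x|))\<close>. Half of the
  exponent of the Gaussian compensates it by \<open>B * u \<le> B\<^sup>2 / 2 + u\<^sup>2 / 2\<close>, and the other half
  leaves the decay \<open>1 / (1 + u\<^sup>2)\<close>, whose integral is elementary.
\<close>

lemma gaussian_absorbs_linear_growth:
  fixes M :: "real \<Rightarrow> real"
  assumes L: "0 < L" "\<And>x t. M x \<le> M t + L * (1 + \<bar>x - t\<bar>)"
  shows "\<exists>K>0. \<forall>x t. exp (b * (M x - M t) - (t - x)\<^sup>2) \<le> K / (1 + (t - x)\<^sup>2)"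
proof -
  define B where "B = \<bar>b\<bar> * L"
  define K where "K = 2 * exp (B + B\<^sup>2 / 2)"
  have "exp (b * (M x - M t) - (t - x)\<^sup>2) \<le> K / (1 + (t - x)\<^sup>2)" for x t
  proof -
    define u where "u = \<bar>t - x\<bar>"
    have u2: "(t - x)\<^sup>2 = u\<^sup>2" by (simp add: u_def)
    have "\<bar>M x - M t\<bar> \<le> L * (1 + u)"
      using L(2)[of x t] L(2)[of t x] by (simp add: u_def abs_minus_commute)
    then have "\<bar>b\<bar> * \<bar>M x - M t\<bar> \<le> B * (1 + u)"
      unfolding B_def by (simp add: mult_left_mono mult.assoc)
    moreover have "b * (M x - M t) \<le> \<bar>b\<bar> * \<bar>M x - M t\<bar>"
      using abs_ge_self[of "b * (M x - M t)"] unfolding abs_mult .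
    ultimately have 1: "b * (M x - M t) \<le> B + B * u"
      by (simp add: distrib_left)
    have 2: "B * u \<le> B\<^sup>2 / 2 + u\<^sup>2 / 2"
      using sum_squares_bound[of B u] by simp
    have "exp (b * (M x - M t) - (t - x)\<^sup>2) \<le> exp ((B + B\<^sup>2 / 2) - u\<^sup>2 / 2)"
      using 1 2 u2 by simp
    also have "\<dots> = exp (B + B\<^sup>2 / 2) / exp (u\<^sup>2 / 2)" by (rule exp_diff)
    also have "\<dots> \<le> exp (B + B\<^sup>2 / 2) / ((1 + u\<^sup>2) / 2)"
    proof (rule divide_left_mono)
      show "(1 + u\<^sup>2) / 2 \<le> exp (u\<^sup>2 / 2)"
        using exp_ge_add_one_self[of "u\<^sup>2 / 2"] unfolding add_divide_distrib
        by (rule order_trans[rotated]) simp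
      show "0 < exp (u\<^sup>2 / 2) * ((1 + u\<^sup>2) / 2)"
        by (simp add: add_pos_nonneg)
    qed simp
    finally show ?thesis by (simp add: K_def u2 mult.commute)
  qed
  moreover have "0 < K" by (simp add: K_def)
  ultimately show ?thesis by blast
qed

lemma norm_integral_le_of_cauchy_density_bound:
  fixes F :: "real \<Rightarrow> complex"
  assumes int: "F integrable_on {a..b}" and "0 \<le> B"
    and le: "\<And>t. t \<in> {a..b} \<Longrightarrow> norm (F t) \<le> B / (1 + (t - x)\<^sup>2)"
  shows "norm (integral {a..b} F) \<le> B * pi"
proof (cases "a \<le> b")
  case True
  have "((\<lambda>t. 1 / (1 + (t - x)\<^sup>2)) has_integral (arctan (b - x) - arctan (a - x))) {a..b}"
  proof (rule fundamental_theorem_of_calculus[OF True])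
    fix t assume "t \<in> {a..b}"
    have "((\<lambda>t. arctan (t - x)) has_real_derivative 1 / (1 + (t - x)\<^sup>2)) (at t within {a..b})"
      by (auto intro!: derivative_eq_intros simp: add_nonneg_eq_0_iff inverse_eq_divide)
    then show "((\<lambda>t. arctan (t - x)) has_vector_derivative 1 / (1 + (t - x)\<^sup>2)) (at t within {a..b})"
      by (simp add: has_real_derivative_iff_has_vector_derivative)
  qed
  from has_integral_mult_right[OF this, of B]
  have I: "((\<lambda>t. B / (1 + (t - x)\<^sup>2)) has_integral B * (arctan (b - x) - arctan (a - x))) {a..b}"
    by simp
  have "norm (integral {a..b} F) \<le> integral {a..b} (\<lambda>t. B / (1 + (t - x)\<^sup>2))"
    using I by (intro integral_norm_bound_integral int le) auto
  also have "\<dots> = B * (arctan (b - x) - arctan (a - x))"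
    using I by (rule integral_unique)
  also have "\<dots> \<le> B * pi"
    using \<open>0 \<le> B\<close> arctan_bounded[of "b - x"] arctan_bounded[of "a - x"]
    by (intro mult_left_mono) linarith+
  finally show ?thesis .
qed (use \<open>0 \<le> B\<close> in simp)

lemma norm_gaussian: "norm (exp (- (w\<^sup>2))) = exp ((Im w)\<^sup>2 - (Re w)\<^sup>2)"
  by (simp add: norm_exp_eq_Re power2_eq_square)

section \<open>Entire truncations of the Cauchy kernel\<close>

text \<open>
  The function \<open>(1 - exp (\<i> \<tau> w)) / w\<close> with its removable singularity filled in. It is \<open>- \<i>\<close> times
  the integral of \<open>exp (\<i> s w)\<close> over \<open>s\<close> from \<open>0\<close> to \<open>\<tau>\<close>. Where \<open>\<tau> * Im w > 0\<close> it differs from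
  \<open>1 / w\<close> only by a term of modulus \<open>exp (- \<tau> * Im w) / |w|\<close>.
\<close>

definition cauchy_truncation :: "real \<Rightarrow> complex \<Rightarrow> complex" where
  "cauchy_truncation \<tau> w = (if w = 0 then - \<i> * \<tau> else (1 - exp (\<i> * \<tau> * w)) / w)"

definition gauss_cauchy :: "real \<Rightarrow> complex \<Rightarrow> complex" where
  "gauss_cauchy \<tau> w = exp (- (w\<^sup>2)) * cauchy_truncation \<tau> w"

lemma cauchy_truncation_holomorphic: "cauchy_truncation \<tau> holomorphic_on UNIV"
proof -
  have "((\<lambda>w. 1 - exp (\<i> * \<tau> * w)) has_field_derivative - \<i> * \<tau>) (at 0)"
    by (auto intro!: derivative_eq_intros)
  then have deriv: "deriv (\<lambda>w. 1 - exp (\<i> * \<tau> * w)) 0 = - \<i> * \<tau>"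
    by (rule DERIV_imp_deriv)
  have eq: "cauchy_truncation \<tau> = (\<lambda>w. if w = 0 then deriv (\<lambda>w. 1 - exp (\<i> * \<tau> * w)) 0
      else ((1 - exp (\<i> * \<tau> * w)) - (1 - exp (\<i> * \<tau> * 0))) / (w - 0))"
    unfolding deriv by (auto simp: fun_eq_iff cauchy_truncation_def)
  show ?thesis
    unfolding eq by (intro pole_lemma_open holomorphic_intros) auto
qed

lemma gauss_cauchy_holomorphic: "gauss_cauchy \<tau> holomorphic_on UNIV"
  unfolding gauss_cauchy_def[abs_def]
  by (intro holomorphic_intros cauchy_truncation_holomorphic)

lemma norm_exp_minus_one_le:
  fixes z :: complex
  shows "norm (1 - exp z) \<le> 4 * norm z * exp \<bar>Re z\<bar>"
proof (cases "norm z \<le> 1 / 2")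
  case True
  then have "norm (exp z - 1) \<le> 3 / 2 * norm z" by (rule norm_exp_bounds)
  also have "\<dots> \<le> 4 * norm z * exp \<bar>Re z\<bar>"
    using mult_mono[of "3 / 2 * norm z" "4 * norm z" 1 "exp \<bar>Re z\<bar>"] by simp
  finally show ?thesis by (simp add: norm_minus_commute)
next
  case False
  have "norm (1 - exp z) \<le> 1 + exp (Re z)"
    using norm_triangle_ineq4[of 1 "exp z"] by (simp add: norm_exp_eq_Re)
  also have "\<dots> \<le> exp \<bar>Re z\<bar> + exp \<bar>Re z\<bar>" by (intro add_mono) auto
  also have "\<dots> = 2 * exp \<bar>Re z\<bar>" by simp
  also have "\<dots> \<le> (4 * norm z) * exp \<bar>Re z\<bar>"
    using False by (intro mult_right_mono) auto
  finally show ?thesis .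
qed

lemma norm_cauchy_truncation_le:
  "norm (cauchy_truncation \<tau> w) \<le> 4 * \<bar>\<tau>\<bar> * exp (\<bar>\<tau>\<bar> * \<bar>Im w\<bar>)"
proof (cases "w = 0")
  case False
  have "norm (1 - exp (\<i> * \<tau> * w)) \<le> 4 * (\<bar>\<tau>\<bar> * norm w) * exp (\<bar>\<tau>\<bar> * \<bar>Im w\<bar>)"
    using norm_exp_minus_one_le[of "\<i> * \<tau> * w"] by (simp add: norm_mult abs_mult)
  then show ?thesis
    using False by (simp add: cauchy_truncation_def norm_divide field_simps)
qed (simp add: cauchy_truncation_def norm_mult)

section \<open>The entire part\<close>

text \<open>
  The contribution of the segment from \<open>- X + \<i> h\<close> to \<open>X + \<i> h\<close> to the modified Cauchy integral. The
  variable \<open>z\<close> occurs only in the entire kernel, so the result is entire although it uses \<open>f\<close>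
  on one segment only.
\<close>

definition line_part :: "real \<Rightarrow> real \<Rightarrow> real \<Rightarrow> (complex \<Rightarrow> complex) \<Rightarrow> complex \<Rightarrow> complex" where
  "line_part h \<tau> X f z =
     integral {- X..X} (\<lambda>t. f (Complex t h) * gauss_cauchy \<tau> (Complex t h - z))"

lemma continuous_on_Complex_line [continuous_intros]:
  "continuous_on A (\<lambda>t. Complex t h)"
  unfolding Complex_eq by (intro continuous_intros)

lemma line_part_integrable:
  assumes "continuous_on UNIV f"
  shows "(\<lambda>t. f (Complex t h) * gauss_cauchy \<tau> (Complex t h - z)) integrable_on {a..b}"
proof -
  have g: "continuous_on UNIV (gauss_cauchy \<tau>)"
    by (rule holomorphic_on_imp_continuous_on[OF gauss_cauchy_holomorphic])
  show ?thesis
    by (intro integrable_continuous_interval continuous_intros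
        continuous_on_compose2[OF assms] continuous_on_compose2[OF g]) auto
qed

lemma line_part_holomorphic:
  assumes f: "continuous_on UNIV f"
  shows "line_part h \<tau> X f holomorphic_on UNIV"
proof -
  define d where "d = deriv (gauss_cauchy \<tau>)"
  have d: "continuous_on UNIV d"
    unfolding d_def
    by (intro holomorphic_on_imp_continuous_on holomorphic_deriv gauss_cauchy_holomorphic) auto
  have "(\<lambda>z. integral (cbox (- X) X) (\<lambda>t. f (Complex t h) * gauss_cauchy \<tau> (Complex t h - z)))
      holomorphic_on UNIV"
  proof (rule leibniz_rule_holomorphic[where fx = "\<lambda>z t. f (Complex t h) * - d (Complex t h - z)"])
    fix z t
    have "(gauss_cauchy \<tau> has_field_derivative d (Complex t h - z)) (at (Complex t h - z))"
      unfolding d_def by (rule holomorphic_derivI[OF gauss_cauchy_holomorphic]) auto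
    then have "((\<lambda>z. gauss_cauchy \<tau> (Complex t h - z)) has_field_derivative
        d (Complex t h - z) * -1) (at z within UNIV)"
      by (rule DERIV_chain2) (auto intro!: derivative_eq_intros)
    from DERIV_cmult[OF this]
    show "((\<lambda>z. f (Complex t h) * gauss_cauchy \<tau> (Complex t h - z)) has_field_derivative
        f (Complex t h) * - d (Complex t h - z)) (at z within UNIV)"
      by simp
  next
    show "continuous_on (UNIV \<times> cbox (- X) X) (\<lambda>(z, t). f (Complex t h) * - d (Complex t h - z))"
      unfolding split_beta Complex_eq
      by (intro continuous_intros continuous_on_compose2[OF f] continuous_on_compose2[OF d]) auto
  qed (use line_part_integrable[OF f] in auto)
  then show ?thesis by (simp add: line_part_def[abs_def])
qed

text \<open>
  The truncated kernel grows at most like \<open>exp (|\<tau>| * |Im (\<zeta> - z)|)\<close>. The weight with exponent \<open>b\<close> at \<open>z\<close>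
  is compared with the weight with exponent \<open>\<alpha>\<close> at \<open>t\<close> in two moves: from \<open>b * M x\<close> to \<open>b * M t\<close> at the
  expense of the Gaussian, and from \<open>b * M t\<close> to \<open>\<alpha> * M t\<close> at the expense of
  \<open>exp (|b - \<alpha>| * m)\<close>, since \<open>M \<le> m\<close> on the segment.
\<close>

lemma line_part_growth:
  fixes M :: "real \<Rightarrow> real"
  assumes f: "continuous_on UNIV f" "\<And>t. norm (f (Complex t h)) \<le> exp (- \<alpha> * M t)"
    and M: "\<And>t. 0 \<le> M t" "\<And>t. \<bar>t\<bar> \<le> X \<Longrightarrow> M t \<le> m"
    and K: "0 < K" "\<And>x t. exp (b * (M x - M t) - (t - x)\<^sup>2) \<le> K / (1 + (t - x)\<^sup>2)"
    and D: "\<bar>h - Im z\<bar> \<le> D"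
  shows "exp (b * M (Re z)) * norm (line_part h \<tau> X f z)
      \<le> 4 * \<bar>\<tau>\<bar> * exp (D\<^sup>2 + \<bar>\<tau>\<bar> * D + \<bar>b - \<alpha>\<bar> * m) * K * pi"
proof -
  define x where "x = Re z"
  define E where "E = 4 * \<bar>\<tau>\<bar> * exp (D\<^sup>2 + \<bar>\<tau>\<bar> * D + \<bar>b - \<alpha>\<bar> * m)"
  have ptw: "norm (of_real (exp (b * M x)) * (f (Complex t h) * gauss_cauchy \<tau> (Complex t h - z)))
      \<le> E * K / (1 + (t - x)\<^sup>2)" if t: "t \<in> {- X..X}" for t
  proof -
    have D2: "(h - Im z)\<^sup>2 \<le> D\<^sup>2" using power_mono[OF D, of 2] by simp
    have "\<bar>\<tau>\<bar> * \<bar>h - Im z\<bar> \<le> \<bar>\<tau>\<bar> * D" using D by (intro mult_left_mono) auto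
    moreover have "(b - \<alpha>) * M t \<le> \<bar>b - \<alpha>\<bar> * m"
      using M(1)[of t] M(2)[of t] t by (intro mult_mono) auto
    ultimately have ex: "b * M x - \<alpha> * M t + ((h - Im z)\<^sup>2 - (t - x)\<^sup>2) + \<bar>\<tau>\<bar> * \<bar>h - Im z\<bar>
        \<le> (D\<^sup>2 + \<bar>\<tau>\<bar> * D + \<bar>b - \<alpha>\<bar> * m) + (b * (M x - M t) - (t - x)\<^sup>2)"
      using D2 by (simp add: algebra_simps)
    have "norm (of_real (exp (b * M x)) * (f (Complex t h) * gauss_cauchy \<tau> (Complex t h - z)))
        \<le> exp (b * M x) * (exp (- \<alpha> * M t) * (exp ((h - Im z)\<^sup>2 - (t - x)\<^sup>2)
            * (4 * \<bar>\<tau>\<bar> * exp (\<bar>\<tau>\<bar> * \<bar>h - Im z\<bar>))))"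
      unfolding norm_mult gauss_cauchy_def norm_gaussian
      using norm_cauchy_truncation_le[of \<tau> "Complex t h - z"]
      by (intro mult_mono f(2)) (auto simp: x_def)
    also have "\<dots> = 4 * \<bar>\<tau>\<bar> * exp (b * M x - \<alpha> * M t + ((h - Im z)\<^sup>2 - (t - x)\<^sup>2) + \<bar>\<tau>\<bar> * \<bar>h - Im z\<bar>)"
      by (simp add: exp_add exp_diff exp_minus field_simps)
    also have "\<dots> \<le> 4 * \<bar>\<tau>\<bar> * exp ((D\<^sup>2 + \<bar>\<tau>\<bar> * D + \<bar>b - \<alpha>\<bar> * m) + (b * (M x - M t) - (t - x)\<^sup>2))"
      using ex by (intro mult_left_mono) auto
    also have "\<dots> = E * exp (b * (M x - M t) - (t - x)\<^sup>2)"
      unfolding E_def by (simp add: exp_add mult.assoc)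
    also have "\<dots> \<le> E * (K / (1 + (t - x)\<^sup>2))"
      by (intro mult_left_mono K(2)) (simp add: E_def)
    finally show ?thesis by simp
  qed
  have "norm (integral {- X..X}
      (\<lambda>t. of_real (exp (b * M x)) * (f (Complex t h) * gauss_cauchy \<tau> (Complex t h - z)))) \<le> E * K * pi"
    using K(1) ptw
    by (intro norm_integral_le_of_cauchy_density_bound[where x = x]
        integrable_on_mult_right line_part_integrable f(1)) (auto simp: E_def)
  then show ?thesis by (simp add: line_part_def norm_mult E_def x_def)
qed

text \<open>
  The integrand of the difference is small everywhere, for two reasons. On the segment
  \<open>|t| \<le> X\<close> only the term with the exponential \<open>exp (\<i> \<tau> w)\<close>, of modulus at most \<open>exp (- \<rho>)\<close>, remains.
  Outside the segment the whole kernel remains, but there the stronger decay of \<open>f\<close> gains the factor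
  \<open>exp (- (\<alpha> - b) * M t) \<le> exp (- \<rho>)\<close>. The bound does not depend on \<open>R\<close>.
\<close>

lemma line_part_error:
  fixes M :: "real \<Rightarrow> real"
  assumes f: "continuous_on UNIV f" "\<And>t. norm (f (Complex t h)) \<le> exp (- \<alpha> * M t)"
    and M: "\<And>t. 0 \<le> M t" "\<And>t. X \<le> \<bar>t\<bar> \<Longrightarrow> \<rho> \<le> (\<alpha> - b) * M t" and "b \<le> \<alpha>"
    and K: "0 < K" "\<And>x t. exp (b * (M x - M t) - (t - x)\<^sup>2) \<le> K / (1 + (t - x)\<^sup>2)"
    and D: "\<bar>h - Im z\<bar> \<le> D" and off: "1 / 2 \<le> \<bar>h - Im z\<bar>"
    and \<tau>: "\<rho> \<le> \<tau> * (h - Im z)" and XR: "X \<le> R"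
  shows "exp (b * M (Re z)) * norm (integral {- R..R}
        (\<lambda>t. f (Complex t h) * exp (- ((Complex t h - z)\<^sup>2)) / (Complex t h - z)) - line_part h \<tau> X f z)
      \<le> 2 * exp (D\<^sup>2 - \<rho>) * K * pi"
proof -
  define x where "x = Re z"
  define w where "w t = Complex t h - z" for t
  define F where "F t = f (Complex t h) * exp (- ((w t)\<^sup>2)) / w t" for t
  define P where "P t = (if t \<in> {- X..X} then f (Complex t h) * gauss_cauchy \<tau> (w t) else 0)" for t
  define E where "E = 2 * exp (D\<^sup>2 - \<rho>)"
  have w: "Re (w t) = t - x" "Im (w t) = h - Im z" "1 / 2 \<le> norm (w t)" "w t \<noteq> 0" for t
  proof -
    show "Re (w t) = t - x" "Im (w t) = h - Im z" by (auto simp: w_def x_def)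
    then show "1 / 2 \<le> norm (w t)" using off abs_Im_le_cmod[of "w t"] by simp
    then show "w t \<noteq> 0" by auto
  qed
  have D2: "(h - Im z)\<^sup>2 \<le> D\<^sup>2" using power_mono[OF D, of 2] by simp
  have F_int: "F integrable_on {- R..R}"
  proof -
    have "continuous_on {- R..R} w" unfolding w_def by (intro continuous_intros)
    then show ?thesis unfolding F_def
      by (intro integrable_continuous_interval continuous_intros
          continuous_on_compose2[OF f(1)]) (auto simp: w)
  qed
  have P_int: "(P has_integral line_part h \<tau> X f z) {- R..R}"
  proof -
    have "((\<lambda>t. f (Complex t h) * gauss_cauchy \<tau> (w t)) has_integral line_part h \<tau> X f z) {- X..X}"
      unfolding line_part_def w_def
      by (intro integrable_integral line_part_integrable f(1))
    then show ?thesis unfolding P_def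
      using XR by (subst has_integral_restrict) auto
  qed
  \<comment> \<open>The common estimate of both cases; \<open>exp s\<close> bounds the exponential if it is present,
    and the factor \<open>2\<close> comes from \<open>1 / |w|\<close>.\<close>
  have gen: "exp (b * M x) * (exp (- \<alpha> * M t) * exp ((h - Im z)\<^sup>2 - (t - x)\<^sup>2) * exp s * 2)
      \<le> E * K / (1 + (t - x)\<^sup>2)" if "s - (\<alpha> - b) * M t \<le> - \<rho>" for s t
  proof -
    have "exp (b * M x) * (exp (- \<alpha> * M t) * exp ((h - Im z)\<^sup>2 - (t - x)\<^sup>2) * exp s * 2)
        = 2 * exp (b * M x - \<alpha> * M t + ((h - Im z)\<^sup>2 - (t - x)\<^sup>2) + s)"
      by (simp add: exp_add exp_diff exp_minus field_simps)
    also have "\<dots> \<le> 2 * exp ((D\<^sup>2 - \<rho>) + (b * (M x - M t) - (t - x)\<^sup>2))"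
      using D2 that by (simp add: algebra_simps)
    also have "\<dots> = E * exp (b * (M x - M t) - (t - x)\<^sup>2)"
      by (simp add: E_def exp_add)
    also have "\<dots> \<le> E * (K / (1 + (t - x)\<^sup>2))"
      by (intro mult_left_mono K(2)) (simp add: E_def)
    finally show ?thesis by simp
  qed
  have quot: "norm (v / w t) \<le> norm v * 2" for v t
  proof -
    have "norm v / norm (w t) \<le> norm v / (1 / 2)"
      using w(3)[of t] by (intro divide_left_mono) auto
    then show ?thesis by (simp add: norm_divide)
  qed
  have ptw: "norm (of_real (exp (b * M x)) * (F t - P t)) \<le> E * K / (1 + (t - x)\<^sup>2)" for t
  proof (cases "t \<in> {- X..X}")
    case True
    have eq: "F t - P t = f (Complex t h) * exp (- ((w t)\<^sup>2)) * exp (\<i> * \<tau> * w t) / w t"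
      using True w(4)[of t]
      by (simp add: F_def P_def gauss_cauchy_def cauchy_truncation_def field_simps)
    have "norm (F t - P t) \<le> norm (f (Complex t h) * exp (- ((w t)\<^sup>2)) * exp (\<i> * \<tau> * w t)) * 2"
      unfolding eq by (rule quot)
    also have "\<dots> \<le> exp (- \<alpha> * M t) * exp ((h - Im z)\<^sup>2 - (t - x)\<^sup>2) * exp (- \<rho>) * 2"
    proof -
      have "norm (exp (\<i> * \<tau> * w t)) \<le> exp (- \<rho>)"
        using \<tau> by (simp add: norm_exp_eq_Re w)
      then show ?thesis
        unfolding norm_mult norm_gaussian w by (intro mult_mono f(2)) auto
    qed
    finally have "exp (b * M x) * norm (F t - P t)
        \<le> exp (b * M x) * (exp (- \<alpha> * M t) * exp ((h - Im z)\<^sup>2 - (t - x)\<^sup>2) * exp (- \<rho>) * 2)"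
      by (intro mult_left_mono) auto
    also have "\<dots> \<le> E * K / (1 + (t - x)\<^sup>2)"
      using \<open>b \<le> \<alpha>\<close> M(1)[of t] by (intro gen) simp
    finally show ?thesis by (simp add: norm_mult)
  next
    case False
    then have "P t = 0" unfolding P_def by (rule if_not_P)
    then have "norm (F t - P t) \<le> norm (f (Complex t h) * exp (- ((w t)\<^sup>2))) * 2"
      using quot by (simp add: F_def)
    also have "\<dots> \<le> exp (- \<alpha> * M t) * exp ((h - Im z)\<^sup>2 - (t - x)\<^sup>2) * exp 0 * 2"
      unfolding norm_mult norm_gaussian w
      using mult_mono[OF f(2) order_refl] by simp
    finally have "exp (b * M x) * norm (F t - P t)
        \<le> exp (b * M x) * (exp (- \<alpha> * M t) * exp ((h - Im z)\<^sup>2 - (t - x)\<^sup>2) * exp 0 * 2)"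
      by (intro mult_left_mono) auto
    also have "\<dots> \<le> E * K / (1 + (t - x)\<^sup>2)"
      using False M(2)[of t] by (intro gen) auto
    finally show ?thesis by (simp add: norm_mult)
  qed
  have int: "(\<lambda>t. F t - P t) integrable_on {- R..R}"
    using F_int P_int by (intro integrable_diff) auto
  have "norm (integral {- R..R} (\<lambda>t. of_real (exp (b * M x)) * (F t - P t))) \<le> E * K * pi"
    using K(1) ptw int
    by (intro norm_integral_le_of_cauchy_density_bound[where x = x]) (auto simp: E_def)
  also have "integral {- R..R} (\<lambda>t. of_real (exp (b * M x)) * (F t - P t))
      = of_real (exp (b * M x)) * (integral {- R..R} F - line_part h \<tau> X f z)"
    using F_int P_int by (simp add: integral_diff has_integral_integrable integral_unique)
  finally show ?thesis by (simp add: norm_mult E_def x_def F_def[abs_def] w_def)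
qed


section \<open>Cauchy's formula on the strip\<close>

lemma has_contour_integral_horizontal_segment:
  assumes "(F has_contour_integral I) (linepath (Complex (- R) h) (Complex R h))" and "0 < R"
  shows "((\<lambda>t. F (Complex t h)) has_integral I) {- R..R}"
proof -
  have lp: "linepath (Complex (- R) h) (Complex R h) t
      = linepath (- of_real R) (of_real R) t + \<i> * of_real h" for t
    by (simp add: linepath_def Complex_eq scaleR_conv_of_real algebra_simps)
  have diff: "Complex R h - Complex (- R) h = of_real R - (- of_real R)"
    by (simp add: complex_eq_iff)
  have "((\<lambda>w. F (w + \<i> * of_real h)) has_contour_integral I) (linepath (- of_real R) (of_real R))"
    using assms(1) unfolding has_contour_integral_linepath lp diff .
  then have "((\<lambda>t. F (of_real t + \<i> * of_real h)) has_integral I) {- R..R}"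
    using \<open>0 < R\<close> by (subst (asm) has_contour_integral_linepath_Reals_iff) auto
  then show ?thesis by (simp add: Complex_eq)
qed

text \<open>
  Cauchy's formula on the rectangle with vertices \<open>\<plusminus> R \<plusminus> \<i> h\<close>; the vertical sides, each of length
  \<open>2 * h\<close>, are moved into the error. The Gaussian factor is \<open>1\<close> at \<open>w = z\<close>, so it does not change the
  value of the formula.
\<close>

lemma cauchy_formula_two_segments:
  fixes f :: "complex \<Rightarrow> complex" and z :: complex
  defines "F \<equiv> \<lambda>w. f w * exp (- ((w - z)\<^sup>2)) / (w - z)"
  assumes f: "f holomorphic_on UNIV" and z: "\<bar>Im z\<bar> < h" "\<bar>Re z\<bar> < R"
    and side: "\<And>w. \<bar>Re w\<bar> = R \<Longrightarrow> \<bar>Im w\<bar> \<le> h \<Longrightarrow> norm (F w) \<le> B"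
  shows "norm (2 * pi * \<i> * f z
      - (integral {- R..R} (\<lambda>t. F (Complex t (- h))) - integral {- R..R} (\<lambda>t. F (Complex t h))))
    \<le> 4 * h * B"
proof -
  define a1 a2 a3 a4 where
    "a1 = Complex (- R) (- h)" "a2 = Complex R (- h)" "a3 = Complex R h" "a4 = Complex (- R) h"
  note a = this
  have hR: "0 < h" "0 < R" using z by auto
  have zbox: "z \<in> box a1 a3" using z by (auto simp: a in_box_complex_iff)
  have "((\<lambda>w. (f w * exp (- ((w - z)\<^sup>2))) / (w - z)) has_contour_integral
      2 * pi * \<i> * winding_number (rectpath a1 a3) z * (f z * exp (- ((z - z)\<^sup>2)))) (rectpath a1 a3)"
  proof (rule Cauchy_integral_formula_convex_simple[where S = UNIV])
    show "path_image (rectpath a1 a3) \<subseteq> UNIV - {z}"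
      using zbox hR by (subst path_image_rectpath_cbox_minus_box) (auto simp: a)
  qed (auto intro!: holomorphic_intros f)
  then have "(F has_contour_integral 2 * pi * \<i> * f z) (rectpath a1 a3)"
    unfolding F_def winding_number_rectpath[OF zbox] by simp
  then have main: "(F has_contour_integral 2 * pi * \<i> * f z)
      (linepath a1 a2 +++ linepath a2 a3 +++ linepath a3 a4 +++ linepath a4 a1)"
    unfolding rectpath_def by (simp add: Let_def a)
  then have "F contour_integrable_on linepath a1 a2" "F contour_integrable_on linepath a2 a3"
      "F contour_integrable_on linepath a3 a4" "F contour_integrable_on linepath a4 a1"
    using has_contour_integral_integrable[OF main] by simp_all
  then obtain i1 i2 i3 i4 where i:
    "(F has_contour_integral i1) (linepath a1 a2)" "(F has_contour_integral i2) (linepath a2 a3)"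
    "(F has_contour_integral i3) (linepath a3 a4)" "(F has_contour_integral i4) (linepath a4 a1)"
    unfolding contour_integrable_on_def by blast
  have "(F has_contour_integral i1 + (i2 + (i3 + i4)))
      (linepath a1 a2 +++ linepath a2 a3 +++ linepath a3 a4 +++ linepath a4 a1)"
    by (intro has_contour_integral_join i) auto
  with main have sum: "2 * pi * \<i> * f z = i1 + (i2 + (i3 + i4))"
    by (rule has_contour_integral_unique)
  have low: "integral {- R..R} (\<lambda>t. F (Complex t (- h))) = i1"
    using has_contour_integral_horizontal_segment[OF _ hR(2)] i(1) integral_unique
    unfolding a by blast
  have "(F has_contour_integral - i3) (linepath a4 a3)"
    using i(3) by (rule has_contour_integral_reverse_linepath)
  then have up: "integral {- R..R} (\<lambda>t. F (Complex t h)) = - i3"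
    using has_contour_integral_horizontal_segment[OF _ hR(2)] integral_unique
    unfolding a by blast
  have "norm (F (Complex R 0)) \<le> B" using hR by (intro side) auto
  then have B: "0 \<le> B" using norm_ge_zero order_trans by blast
  have "norm i2 \<le> B * norm (a3 - a2)"
    using hR by (intro has_contour_integral_bound_linepath[OF i(2) B] side)
      (auto simp: a closed_segment_same_Re closed_segment_eq_real_ivl)
  also have "norm (a3 - a2) = 2 * h"
    using hR by (simp add: a cmod_def real_sqrt_mult)
  finally have 2: "norm i2 \<le> 2 * h * B" by (simp add: mult.commute)
  have "norm i4 \<le> B * norm (a1 - a4)"
    using hR by (intro has_contour_integral_bound_linepath[OF i(4) B] side)
      (auto simp: a closed_segment_same_Re closed_segment_eq_real_ivl)
  also have "norm (a1 - a4) = 2 * h"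
    using hR by (simp add: a cmod_def real_sqrt_mult)
  finally have 4: "norm i4 \<le> 2 * h * B" by (simp add: mult.commute)
  have "norm (i2 + i4) \<le> 4 * h * B"
    using norm_triangle_ineq[of i2 i4] 2 4 by simp
  then show ?thesis unfolding low up sum by (simp add: algebra_simps)
qed

section \<open>Splitting a function into an entire part and a small remainder\<close>

text \<open>
  The frequencies on the two lines have opposite signs because \<open>Im (\<zeta> - z)\<close> is positive on the upper
  and negative on the lower line, when \<open>z\<close> is between them.
\<close>

definition entire_part :: "real \<Rightarrow> real \<Rightarrow> real \<Rightarrow> (complex \<Rightarrow> complex) \<Rightarrow> complex \<Rightarrow> complex" where
  "entire_part h T X f z =
     (line_part (- h) (- T) X f z - line_part h T X f z) / (2 * pi * \<i>)"

lemma entire_part_holomorphic: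
  "continuous_on UNIV f \<Longrightarrow> entire_part h T X f holomorphic_on UNIV"
  unfolding entire_part_def[abs_def] by (intro holomorphic_intros line_part_holomorphic) auto

text \<open>
  With the frequency \<open>2 * ln r\<close> and \<open>M X = M 0 + \<kappa> * ln r\<close> the exponentials in \<open>line_part_growth\<close>
  become the power of \<open>r\<close> with exponent \<open>2 * (h + k) + |b - \<alpha>| * \<kappa>\<close>; one more power of \<open>r\<close> bounds the
  linear factor \<open>|\<tau>| = 2 * ln r\<close>.
\<close>

lemma entire_part_growth:
  fixes M :: "real \<Rightarrow> real"
  assumes M: "\<And>t. 0 \<le> M t" "\<And>x y. \<bar>x\<bar> \<le> \<bar>y\<bar> \<Longrightarrow> M x \<le> M y"
    and L: "0 < L" "\<And>x t. M x \<le> M t + L * (1 + \<bar>x - t\<bar>)"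
    and h: "0 \<le> h"
  shows "\<exists>n\<ge>1. \<exists>C>0. \<forall>r\<ge>1. \<forall>X f z. continuous_on UNIV f \<longrightarrow>
      (\<forall>w. \<bar>Im w\<bar> \<le> h \<longrightarrow> norm (f w) \<le> exp (- \<alpha> * M (Re w))) \<longrightarrow> 0 \<le> X \<longrightarrow> M X = M 0 + \<kappa> * ln r \<longrightarrow>
      \<bar>Im z\<bar> < k \<longrightarrow> exp (b * M (Re z)) * norm (entire_part h (2 * ln r) X f z) \<le> C * r ^ n"
proof -
  obtain K where K: "0 < K" "\<And>x t. exp (b * (M x - M t) - (t - x)\<^sup>2) \<le> K / (1 + (t - x)\<^sup>2)"
    using gaussian_absorbs_linear_growth[of L M b, OF L] by blast
  define D where "D = h + k"
  define s where "s = 2 * D + \<bar>b - \<alpha>\<bar> * \<kappa>"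
  define n where "n = nat \<lceil>s\<rceil> + 1"
  define C where "C = 8 * exp (D\<^sup>2 + \<bar>b - \<alpha>\<bar> * M 0) * K"
  have "exp (b * M (Re z)) * norm (entire_part h (2 * ln r) X f z) \<le> C * r ^ n"
    if r: "1 \<le> r" and f: "continuous_on UNIV f"
      and fb: "\<And>w. \<bar>Im w\<bar> \<le> h \<Longrightarrow> norm (f w) \<le> exp (- \<alpha> * M (Re w))"
      and X: "0 \<le> X" "M X = M 0 + \<kappa> * ln r" and z: "\<bar>Im z\<bar> < k" for r X f z
  proof -
    have l: "0 \<le> ln r" "ln r \<le> r" using r ln_le_minus_one[of r] by auto
    define G where "G = 4 * (2 * ln r) * exp (D\<^sup>2 + 2 * ln r * D + \<bar>b - \<alpha>\<bar> * (M 0 + \<kappa> * ln r)) * K * pi"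
    have line: "exp (b * M (Re z)) * norm (line_part c \<tau> X f z) \<le> G"
      if "\<bar>c\<bar> = h" "\<bar>\<tau>\<bar> = 2 * ln r" for c \<tau>
    proof -
      have "exp (b * M (Re z)) * norm (line_part c \<tau> X f z)
          \<le> 4 * \<bar>\<tau>\<bar> * exp (D\<^sup>2 + \<bar>\<tau>\<bar> * D + \<bar>b - \<alpha>\<bar> * (M 0 + \<kappa> * ln r)) * K * pi"
      proof (rule line_part_growth[OF f _ M(1) _ K])
        show "norm (f (Complex t c)) \<le> exp (- \<alpha> * M t)" for t
          using fb[of "Complex t c"] that by simp
        show "M t \<le> M 0 + \<kappa> * ln r" if "\<bar>t\<bar> \<le> X" for t
          using M(2)[of t X] that X by simp
        show "\<bar>c - Im z\<bar> \<le> D" using that z unfolding D_def by linarith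
      qed
      then show ?thesis unfolding G_def that .
    qed
    have "exp (b * M (Re z)) * norm (entire_part h (2 * ln r) X f z)
        = exp (b * M (Re z)) * norm (line_part (- h) (- (2 * ln r)) X f z - line_part h (2 * ln r) X f z) / (2 * pi)"
      by (simp add: entire_part_def norm_divide norm_mult)
    also have "\<dots> \<le> (exp (b * M (Re z)) * norm (line_part (- h) (- (2 * ln r)) X f z)
        + exp (b * M (Re z)) * norm (line_part h (2 * ln r) X f z)) / (2 * pi)"
      using norm_triangle_ineq4 by (intro divide_right_mono) (auto simp: distrib_left[symmetric])
    also have "\<dots> \<le> (G + G) / (2 * pi)"
      using h l by (intro divide_right_mono add_mono line) auto
    also have "\<dots> = C * ln r * exp (s * ln r)"
    proof -
      have "exp (D\<^sup>2 + 2 * ln r * D + \<bar>b - \<alpha>\<bar> * (M 0 + \<kappa> * ln r))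
          = exp (D\<^sup>2 + \<bar>b - \<alpha>\<bar> * M 0) * exp (s * ln r)"
        unfolding s_def by (simp add: exp_add[symmetric] algebra_simps)
      then show ?thesis by (simp add: G_def C_def)
    qed
    also have "\<dots> \<le> C * r * r ^ nat \<lceil>s\<rceil>"
    proof (intro mult_mono)
      have "s * ln r \<le> real (nat \<lceil>s\<rceil>) * ln r"
        using l by (intro mult_right_mono) linarith+
      then have "exp (s * ln r) \<le> exp (real (nat \<lceil>s\<rceil>) * ln r)" by simp
      also have "\<dots> = r ^ nat \<lceil>s\<rceil>"
        using r by (simp add: exp_of_nat_mult)
      finally show "exp (s * ln r) \<le> r ^ nat \<lceil>s\<rceil>" .
    qed (use K l r in \<open>auto simp: C_def\<close>)
    also have "\<dots> = C * r ^ n" by (simp add: n_def)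
    finally show ?thesis .
  qed
  moreover have "1 \<le> n" "0 < C" using K by (auto simp: n_def C_def)
  ultimately show ?thesis by blast
qed

text \<open>
  The lines at height \<open>\<plusminus> h\<close> have distance more than \<open>1/2\<close> from \<open>z\<close>, so the frequency \<open>2 * ln r\<close> and the
  cut-off \<open>X\<close> both produce the factor \<open>exp (- ln r)\<close> in \<open>line_part_error\<close>. The vertical sides in
  Cauchy's formula disappear as \<open>R\<close> tends to infinity, since the Gaussian also absorbs the weight
  with exponent \<open>\<alpha>\<close>.
\<close>

lemma entire_part_error:
  fixes M :: "real \<Rightarrow> real"
  assumes M: "\<And>t. 0 \<le> M t" "\<And>x y. \<bar>x\<bar> \<le> \<bar>y\<bar> \<Longrightarrow> M x \<le> M y"
    and L: "0 < L" "\<And>x t. M x \<le> M t + L * (1 + \<bar>x - t\<bar>)"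
    and b: "b < \<alpha>" and p: "0 \<le> p" and h: "h = p + 1 / 2"
  shows "\<exists>C. \<forall>r\<ge>1. \<forall>X f z. f holomorphic_on UNIV \<longrightarrow>
      (\<forall>w. \<bar>Im w\<bar> \<le> h \<longrightarrow> norm (f w) \<le> exp (- \<alpha> * M (Re w))) \<longrightarrow> 0 \<le> X \<longrightarrow>
      M X = M 0 + 1 / (\<alpha> - b) * ln r \<longrightarrow> \<bar>Im z\<bar> < p \<longrightarrow>
      exp (b * M (Re z)) * norm (f z - entire_part h (2 * ln r) X f z) \<le> C / r"
proof -
  obtain K where K: "0 < K" "\<And>x t. exp (b * (M x - M t) - (t - x)\<^sup>2) \<le> K / (1 + (t - x)\<^sup>2)"
    using gaussian_absorbs_linear_growth[of L M b, OF L] by blast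
  obtain K' where K': "0 < K'" "\<And>x t. exp (\<alpha> * (M x - M t) - (t - x)\<^sup>2) \<le> K' / (1 + (t - x)\<^sup>2)"
    using gaussian_absorbs_linear_growth[of L M \<alpha>, OF L] by blast
  define D where "D = h + p"
  define C where "C = 2 * exp (D\<^sup>2) * K"
  have "exp (b * M (Re z)) * norm (f z - entire_part h (2 * ln r) X f z) \<le> C / r"
    if r: "1 \<le> r" and f: "f holomorphic_on UNIV"
      and fb: "\<And>w. \<bar>Im w\<bar> \<le> h \<Longrightarrow> norm (f w) \<le> exp (- \<alpha> * M (Re w))"
      and X: "0 \<le> X" "M X = M 0 + 1 / (\<alpha> - b) * ln r" and z: "\<bar>Im z\<bar> < p" for r X f z
  proof -
    have cf: "continuous_on UNIV f" by (rule holomorphic_on_imp_continuous_on[OF f])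
    define x where "x = Re z"
    define e where "e = exp (b * M x)"
    define J where "J R c = integral {- R..R}
        (\<lambda>t. f (Complex t c) * exp (- ((Complex t c - z)\<^sup>2)) / (Complex t c - z))" for R c
    define Q where "Q = line_part (- h) (- (2 * ln r)) X f z - line_part h (2 * ln r) X f z"
    define E where "E = exp (D\<^sup>2) * K' * exp (- \<alpha> * M x)"
    have E: "0 < E" using K' by (simp add: E_def)
    have l: "0 \<le> ln r" using r by simp
    have line: "e * norm (J R c - line_part c \<tau> X f z) \<le> 2 * exp (D\<^sup>2 - ln r) * K * pi"
      if R: "X \<le> R" and c: "c = h \<and> \<tau> = 2 * ln r \<or> c = - h \<and> \<tau> = - (2 * ln r)" for R c \<tau>
      unfolding J_def e_def x_def
    proof (rule line_part_error[OF cf _ M(1) _ _ K])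
      show "norm (f (Complex t c)) \<le> exp (- \<alpha> * M t)" for t
        using fb[of "Complex t c"] c h p by auto
      show "ln r \<le> (\<alpha> - b) * M t" if "X \<le> \<bar>t\<bar>" for t
      proof -
        have "(1 / (\<alpha> - b)) * ln r \<le> M t"
          using M(2)[of X t] M(1)[of 0] that X by simp
        then show ?thesis using b by (simp add: field_simps)
      qed
      show "\<bar>c - Im z\<bar> \<le> D" using c z h p unfolding D_def by auto
      show "1 / 2 \<le> \<bar>c - Im z\<bar>" using c z h p by auto
      have "ln r * 1 \<le> ln r * (2 * (h - Im z))" "ln r * 1 \<le> ln r * (2 * (h + Im z))"
        using l z h by (intro mult_left_mono; auto)+
      then show "ln r \<le> \<tau> * (c - Im z)" using c by (auto simp: algebra_simps)
    qed (use b R in auto)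
    have cauchy: "norm (2 * pi * \<i> * f z - (J R (- h) - J R h)) \<le> 4 * h * (E / (R - \<bar>x\<bar>))"
      if R: "\<bar>x\<bar> + 1 \<le> R" for R
      unfolding J_def
    proof (rule cauchy_formula_two_segments[OF f])
      fix w assume w: "\<bar>Re w\<bar> = R" "\<bar>Im w\<bar> \<le> h"
      define u where "u = \<bar>Re w - x\<bar>"
      have u: "R - \<bar>x\<bar> \<le> u" "1 \<le> u" using w(1) R unfolding u_def by linarith+
      have dist: "1 \<le> norm (w - z)"
        using abs_Re_le_cmod[of "w - z"] u by (simp add: u_def x_def)
      have "\<bar>Im w - Im z\<bar> \<le> D" using w z unfolding D_def by linarith
      then have D2: "(Im w - Im z)\<^sup>2 \<le> D\<^sup>2" using power_mono[of "\<bar>Im w - Im z\<bar>" D 2] by simp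
      have "norm (f w * exp (- ((w - z)\<^sup>2)) / (w - z)) \<le> norm (f w * exp (- ((w - z)\<^sup>2))) / 1"
        unfolding norm_divide using dist by (intro divide_left_mono) auto
      also have "\<dots> \<le> exp (- \<alpha> * M (Re w)) * exp (D\<^sup>2 - (Re w - x)\<^sup>2)"
        unfolding norm_mult norm_gaussian using fb[OF w(2)] D2
        by (simp add: x_def) (intro mult_mono; simp)
      also have "\<dots> = exp (D\<^sup>2) * exp (- \<alpha> * M x) * exp (\<alpha> * (M x - M (Re w)) - (Re w - x)\<^sup>2)"
        by (simp add: exp_add[symmetric] algebra_simps)
      also have "\<dots> \<le> exp (D\<^sup>2) * exp (- \<alpha> * M x) * (K' / (1 + (Re w - x)\<^sup>2))"
        by (intro mult_left_mono K') auto
      also have "\<dots> = E / (1 + u\<^sup>2)" by (simp add: E_def u_def)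
      also have "\<dots> \<le> E / (R - \<bar>x\<bar>)"
      proof (rule divide_left_mono)
        have "u \<le> u\<^sup>2" using u by (simp add: power2_eq_square)
        then show "R - \<bar>x\<bar> \<le> 1 + u\<^sup>2" using u by linarith
        show "0 < (1 + u\<^sup>2) * (R - \<bar>x\<bar>)" using R by (intro mult_pos_pos) (auto simp: add_pos_nonneg)
      qed (use E in simp)
      finally show "norm (f w * exp (- ((w - z)\<^sup>2)) / (w - z)) \<le> E / (R - \<bar>x\<bar>)" .
    qed (use z h R in \<open>auto simp: x_def\<close>)
    have "e * norm (2 * pi * \<i> * f z - Q) \<le> 4 * exp (D\<^sup>2 - ln r) * K * pi"
    proof (rule field_le_epsilon)
      fix \<epsilon> :: real assume eps: "0 < \<epsilon>"
      \<comment> \<open>So large that the rectangle contains the cut-off segments and the vertical sides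
        contribute at most \<open>\<epsilon>\<close>.\<close>
      define R where "R = \<bar>x\<bar> + 1 + X + e * (4 * h * E) / \<epsilon>"
      have pos: "0 \<le> e * (4 * h * E)" using h p E by (simp add: e_def)
      then have R: "\<bar>x\<bar> + 1 \<le> R" "X \<le> R" "e * (4 * h * E) / \<epsilon> \<le> R - \<bar>x\<bar>"
        using X(1) eps unfolding R_def by (auto intro: add_nonneg_nonneg)
      have "e * (4 * h * (E / (R - \<bar>x\<bar>))) \<le> \<epsilon>"
        using R eps by (simp add: field_simps)
      then have 1: "e * norm (2 * pi * \<i> * f z - (J R (- h) - J R h)) \<le> \<epsilon>"
        using mult_left_mono[OF cauchy[OF R(1)], of e] by (simp add: e_def)
      have "2 * pi * \<i> * f z - Q = (2 * pi * \<i> * f z - (J R (- h) - J R h))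
          + ((J R (- h) - line_part (- h) (- (2 * ln r)) X f z) - (J R h - line_part h (2 * ln r) X f z))"
        by (simp add: Q_def)
      then have "norm (2 * pi * \<i> * f z - Q) \<le> norm (2 * pi * \<i> * f z - (J R (- h) - J R h))
          + (norm (J R (- h) - line_part (- h) (- (2 * ln r)) X f z)
             + norm (J R h - line_part h (2 * ln r) X f z))"
        by (metis (no_types) norm_triangle_ineq4 norm_triangle_le add_left_mono)
      then have "e * norm (2 * pi * \<i> * f z - Q) \<le> e * (norm (2 * pi * \<i> * f z - (J R (- h) - J R h))
          + (norm (J R (- h) - line_part (- h) (- (2 * ln r)) X f z)
             + norm (J R h - line_part h (2 * ln r) X f z)))"
        by (intro mult_left_mono) (auto simp: e_def)
      then show "e * norm (2 * pi * \<i> * f z - Q) \<le> 4 * exp (D\<^sup>2 - ln r) * K * pi + \<epsilon>"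
        using 1 line[OF R(2), of h "2 * ln r"] line[OF R(2), of "- h" "- (2 * ln r)"]
        by (simp add: distrib_left)
    qed
    then have "e * norm (2 * pi * \<i> * f z - Q) / (2 * pi) \<le> 4 * exp (D\<^sup>2 - ln r) * K * pi / (2 * pi)"
      by (intro divide_right_mono) auto
    also have "\<dots> = 2 * exp (D\<^sup>2 - ln r) * K" by simp
    finally have Q_le: "e * norm (2 * pi * \<i> * f z - Q) / (2 * pi) \<le> 2 * exp (D\<^sup>2 - ln r) * K" .
    have "f z - entire_part h (2 * ln r) X f z = (2 * pi * \<i> * f z - Q) / (2 * pi * \<i>)"
      by (simp add: entire_part_def Q_def field_simps)
    then have "norm (f z - entire_part h (2 * ln r) X f z) = norm (2 * pi * \<i> * f z - Q) / (2 * pi)"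
      by (simp add: norm_divide norm_mult)
    with Q_le have "e * norm (f z - entire_part h (2 * ln r) X f z) \<le> 2 * exp (D\<^sup>2 - ln r) * K"
      by simp
    also have "\<dots> = C / r" using r by (simp add: C_def exp_diff)
    finally show ?thesis by (simp add: e_def x_def)
  qed
  then show ?thesis by blast
qed


section \<open>Strong weight generators and the space\<close>

text \<open>
  As \<open>ln (1 + x)\<close> is \<open>o(\<mu> x)\<close>, the weight is unbounded, and the intermediate value theorem applies.
\<close>

lemma strong_weight_generator_attains:
  assumes \<mu>: "strong_weight_generator \<mu>" and c: "\<mu> 0 \<le> c"
  shows "\<exists>X\<ge>0. \<mu> (complex_of_real X) = c"
proof -
  have cont: "continuous_on UNIV \<mu>" and nonneg: "\<And>z. 0 \<le> \<mu> z"
    and sm: "strict_mono_on {0..} (\<lambda>x::real. \<mu> (complex_of_real x))"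
    and lim: "((\<lambda>x::real. ln (1 + \<bar>x\<bar>) / \<mu> (complex_of_real x)) \<longlongrightarrow> 0) at_top"
    using \<mu> unfolding strong_weight_generator_def by auto
  have "\<forall>\<^sub>F x::real in at_top. ln (1 + \<bar>x\<bar>) / \<mu> (complex_of_real x) < 1"
    using lim by (rule order_tendstoD) simp
  then have "\<forall>\<^sub>F x::real in at_top. ln (1 + \<bar>x\<bar>) / \<mu> (complex_of_real x) < 1 \<and> exp c < x"
    using eventually_gt_at_top by (rule eventually_conj)
  then obtain x :: real where x: "ln (1 + \<bar>x\<bar>) / \<mu> (complex_of_real x) < 1" "exp c < x"
    by (metis (mono_tags, lifting) eventually_happens trivial_limit_at_top_linorder)
  have x0: "0 < x" using x(2) exp_gt_zero[of c] by linarith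
  have "0 < \<mu> (complex_of_real x)"
    using strict_mono_onD[OF sm, of 0 x] x0 nonneg[of 0] by simp
  then have "ln (1 + \<bar>x\<bar>) < \<mu> (complex_of_real x)" using x(1) by (simp add: field_simps)
  moreover have "c \<le> ln (1 + \<bar>x\<bar>)" using x(2) x0 by (subst ln_ge_iff) auto
  ultimately have "c \<le> \<mu> (complex_of_real x)" by linarith
  moreover have "continuous_on {0..x} (\<lambda>x. \<mu> (complex_of_real x))"
    by (intro continuous_on_compose2[OF cont] continuous_intros) auto
  ultimately show ?thesis
    using IVT'[of "\<lambda>x. \<mu> (complex_of_real x)" 0 c x] c x0 by auto
qed

text \<open>
  The bound comes from the instance of clause (b) in which both weights have the same exponent \<open>a m\<close>,
  where \<open>m = I\<^sub>1 (I\<^sub>4 1)\<close>. Since \<open>m > 1\<close>, this exponent is not \<open>0\<close>: it is negative, or greater than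
  \<open>a 1 \<ge> 0\<close>.
\<close>

lemma condition_D_imp_linear_growth:
  fixes \<mu> :: "complex \<Rightarrow> real"
  assumes \<mu>: "strong_weight_generator \<mu>"
    and a: "strict_mono_on {1..} a" "(\<forall>n\<ge>1. a n < 0) \<or> (\<forall>n\<ge>1. a n \<ge> 0)"
    and D: "condition_D UNIV strip (\<lambda>n z. exp (a n * \<mu> z)) g I\<^sub>1 I\<^sub>2 I\<^sub>4 X"
  shows "\<exists>L>0. \<forall>x t. \<mu> (of_real x) \<le> \<mu> (of_real t) + L * (1 + \<bar>x - t\<bar>)"
proof -
  have even: "\<And>z. \<mu> z = \<mu> (complex_of_real \<bar>Re z\<bar>)"
    and sm: "strict_mono_on {0..} (\<lambda>x::real. \<mu> (complex_of_real x))"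
    using \<mu> unfolding strong_weight_generator_def by auto
  define M where "M x = \<mu> (complex_of_real x)" for x
  have \<mu>_Re: "\<mu> z = M (Re z)" for z
    unfolding M_def by (subst (1 2) even) simp
  have mono: "M x \<le> M y" if "0 \<le> x" "x \<le> y" for x y
    unfolding M_def using strict_mono_on_leD[OF sm, of x y] that by simp
  define m where "m = I\<^sub>1 (I\<^sub>4 1)"
  have "1 < I\<^sub>4 1" using D unfolding condition_D_def condition_D_b_def by auto
  moreover have "I\<^sub>4 1 < m"
    using D calculation unfolding condition_D_def condition_D_a_def m_def by auto
  ultimately have m: "1 < I\<^sub>4 1" "1 < m" by auto
  then have g: "g m holomorphic_on UNIV" "g m 0 = 1"
    using D unfolding condition_D_def condition_D_a_def by auto
  have "a 1 < a m" using strict_mono_onD[OF a(1), of 1 m] m by simp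
  moreover have "a m < 0 \<or> 0 \<le> a 1" using a(2) m by auto
  ultimately have am: "a m \<noteq> 0" by linarith
  obtain A where A: "0 < A" "\<And>x. x \<in> strip m \<Longrightarrow>
      (\<integral>\<^sup>+y\<in>strip (I\<^sub>4 1). ennreal (norm (g m (x - y)) * exp (a m * \<mu> x)
          / (norm (x - y) * exp (a m * \<mu> y))) \<partial>lborel) \<le> ennreal A"
    using D unfolding condition_D_def condition_D_b_def m_def by force
  have "\<exists>h>0. \<exists>C. \<forall>x\<ge>h. M (x + h) \<le> M x + C"
  proof (rule cauchy_kernel_bound_imp_increment_bound[where G = "g m" and c = "a m"
        and S = "strip (I\<^sub>4 1)"])
    show "isCont (g m) 0"
      using holomorphic_on_imp_continuous_on[OF g(1)] by (simp add: continuous_on_eq_continuous_at)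
    show "{z. \<bar>Im z\<bar> < 1} \<subseteq> strip (I\<^sub>4 1)" using m by (auto simp: strip_def)
    show "(\<integral>\<^sup>+y\<in>strip (I\<^sub>4 1). ennreal (norm (g m (of_real x - y)) * exp (a m * M x)
        / (norm (of_real x - y) * exp (a m * M (Re y)))) \<partial>lborel) \<le> ennreal A" for x
      using A(2)[of "of_real x"] m by (simp add: strip_def \<mu>_Re)
  qed (use mono g am A in auto)
  then obtain h C where h: "0 < h" "\<And>x. h \<le> x \<Longrightarrow> M (x + h) \<le> M x + C" by blast
  have "M x = M \<bar>x\<bar>" for x
    unfolding M_def by (subst even) simp
  from increment_bound_imp_linear_growth[of M h C, OF this mono h]
  show ?thesis by (simp add: M_def)
qed

lemma OV_ball_bound:
  assumes "f \<in> seminorm_ball (OV \<Omega> \<nu>) (weighted_sup \<Omega> \<nu>) n" "1 \<le> n" "z \<in> \<Omega> n"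
  shows "norm (f z) * \<nu> n z \<le> 1"
proof -
  have "norm (f z) * \<nu> n z \<le> weighted_sup \<Omega> \<nu> n f"
    using assms unfolding seminorm_ball_def weighted_sup_def OV_def
    by (intro cSUP_upper) auto
  then show ?thesis using assms(1) by (simp add: seminorm_ball_def)
qed

lemma scaled_ballI:
  assumes "0 < c" "f \<in> OV \<Omega> \<nu>" "\<Omega> n \<noteq> {}"
    and "\<And>z. z \<in> \<Omega> n \<Longrightarrow> norm (f z) * \<nu> n z \<le> c"
  shows "f \<in> pointwise_scale c ` seminorm_ball (OV \<Omega> \<nu>) (weighted_sup \<Omega> \<nu>) n"
proof
  show "f = pointwise_scale c (pointwise_scale (1 / c) f)"
    using \<open>0 < c\<close> by (simp add: pointwise_scale_def fun_eq_iff)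
  have "bdd_above ((\<lambda>z. norm (pointwise_scale (1 / c) f z) * \<nu> k z) ` \<Omega> k)" if k: "1 \<le> k" for k
  proof -
    obtain B where "\<And>z. z \<in> \<Omega> k \<Longrightarrow> norm (f z) * \<nu> k z \<le> B"
      using assms(2) k unfolding OV_def bdd_above_def by fastforce
    then have "norm (pointwise_scale (1 / c) f z) * \<nu> k z \<le> B / c" if "z \<in> \<Omega> k" for z
      using that \<open>0 < c\<close> by (simp add: pointwise_scale_def norm_mult norm_divide divide_right_mono)
    then show ?thesis by (rule bdd_aboveI2)
  qed
  moreover have "pointwise_scale (1 / c) f holomorphic_on UNIV"
    using assms(2) unfolding pointwise_scale_def OV_def by (auto intro!: holomorphic_intros)
  moreover have "weighted_sup \<Omega> \<nu> n (pointwise_scale (1 / c) f) \<le> 1"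
    unfolding weighted_sup_def
    using assms(1,3,4) by (intro cSUP_least) (auto simp: pointwise_scale_def norm_mult norm_divide)
  ultimately show "pointwise_scale (1 / c) f \<in> seminorm_ball (OV \<Omega> \<nu>) (weighted_sup \<Omega> \<nu>) n"
    by (auto simp: seminorm_ball_def OV_def)
qed

lemma OV_diff:
  assumes "f \<in> OV \<Omega> \<nu>" "g \<in> OV \<Omega> \<nu>" and "\<And>n z. 0 \<le> \<nu> n z"
  shows "(\<lambda>z. f z - g z) \<in> OV \<Omega> \<nu>"
proof -
  have "bdd_above ((\<lambda>z. norm (f z - g z) * \<nu> n z) ` \<Omega> n)" if n: "1 \<le> n" for n
  proof -
    obtain A B where AB: "\<And>z. z \<in> \<Omega> n \<Longrightarrow> norm (f z) * \<nu> n z \<le> A"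
        "\<And>z. z \<in> \<Omega> n \<Longrightarrow> norm (g z) * \<nu> n z \<le> B"
      using assms(1,2) n unfolding OV_def bdd_above_def by fastforce
    have "norm (f z - g z) * \<nu> n z \<le> A + B" if "z \<in> \<Omega> n" for z
    proof -
      have "norm (f z - g z) * \<nu> n z \<le> (norm (f z) + norm (g z)) * \<nu> n z"
        by (intro mult_right_mono norm_triangle_ineq4 assms(3))
      then show ?thesis using AB[OF that] by (simp add: distrib_right)
    qed
    then show ?thesis by (rule bdd_aboveI2)
  qed
  then show ?thesis using assms by (auto simp: OV_def intro!: holomorphic_intros)
qed

theorem theorem4p3:
  fixes \<mu> :: "complex \<Rightarrow> real" and a :: "nat \<Rightarrow> real"
    and \<nu> :: "nat \<Rightarrow> complex \<Rightarrow> real"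
    and g :: "nat \<Rightarrow> complex \<Rightarrow> complex"
    and I\<^sub>1 I\<^sub>2 I\<^sub>4 :: "nat \<Rightarrow> nat"
    and X :: "nat \<Rightarrow> complex set"
  assumes "strong_weight_generator \<mu>"
    and "strict_mono_on {1..} a"
    and "(\<forall>n\<ge>1. a n < 0) \<or> (\<forall>n\<ge>1. a n \<ge> 0)"
    and "a \<longlonglongrightarrow> 0 \<or> filterlim a at_top sequentially"
    and "\<nu> = (\<lambda>n z. exp (a n * \<mu> z))"
    and "condition_D UNIV strip \<nu> g I\<^sub>1 I\<^sub>2 I\<^sub>4 X"
    and "\<forall>n\<ge>1. I\<^sub>2 (I\<^sub>1 (I\<^sub>4 n)) \<ge> I\<^sub>1 (I\<^sub>4 (n + 1))"
    and "condition_omega1 strip \<nu>"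
  shows "property_Omega pointwise_scale (OV strip \<nu>) (weighted_sup strip \<nu>)"
proof -
  have even: "\<And>z. \<mu> z = \<mu> (complex_of_real \<bar>Re z\<bar>)" and nonneg: "\<And>z. 0 \<le> \<mu> z"
    and sm: "strict_mono_on {0..} (\<lambda>x::real. \<mu> (complex_of_real x))"
    using assms(1) unfolding strong_weight_generator_def by auto
  define M where "M x = \<mu> (complex_of_real x)" for x
  have \<mu>_Re: "\<mu> z = M (Re z)" for z
    unfolding M_def by (subst (1 2) even) simp
  have M: "0 \<le> M x" for x by (simp add: M_def nonneg)
  have mono: "M x \<le> M y" if "\<bar>x\<bar> \<le> \<bar>y\<bar>" for x y
  proof -
    have "\<mu> (complex_of_real \<bar>x\<bar>) \<le> \<mu> (complex_of_real \<bar>y\<bar>)"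
      using strict_mono_on_leD[OF sm, of "\<bar>x\<bar>" "\<bar>y\<bar>"] that by simp
    then show ?thesis unfolding M_def by (subst (1 2) even) simp
  qed
  obtain L where L: "0 < L" "\<And>x t. M x \<le> M t + L * (1 + \<bar>x - t\<bar>)"
    using condition_D_imp_linear_growth[OF assms(1,2,3)] assms(5,6) unfolding M_def by blast
  have a_less: "a i < a j" if "1 \<le> i" "i < j" for i j
    using strict_mono_onD[OF assms(2), of i j] that by simp
  have \<nu>: "\<nu> n z = exp (a n * M (Re z))" for n z by (simp add: assms(5) \<mu>_Re)
  let ?V = "OV strip \<nu>" and ?B = "seminorm_ball (OV strip \<nu>) (weighted_sup strip \<nu>)"
  have strip: "strip n \<noteq> {}" if "1 \<le> n" for n
    using that by (auto simp: strip_def intro!: exI[of _ 0])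
  show ?thesis
    unfolding property_Omega_def
  proof (intro allI impI)
    fix p :: nat assume p: "1 \<le> p"
    define q where "q = p + 1"
    define h where "h = real p + 1 / 2"
    define \<kappa> where "\<kappa> = 1 / (a q - a p)"
    have pq: "a p < a q" using a_less[of p q] p by (simp add: q_def)
    then have \<kappa>: "0 < \<kappa>" by (simp add: \<kappa>_def)
    obtain C' where error: "\<forall>r\<ge>1. \<forall>X f z. f holomorphic_on UNIV \<longrightarrow>
        (\<forall>w. \<bar>Im w\<bar> \<le> h \<longrightarrow> norm (f w) \<le> exp (- a q * M (Re w))) \<longrightarrow> 0 \<le> X \<longrightarrow>
        M X = M 0 + \<kappa> * ln r \<longrightarrow> \<bar>Im z\<bar> < real p \<longrightarrow>
        exp (a p * M (Re z)) * norm (f z - entire_part h (2 * ln r) X f z) \<le> C' / r"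
      using entire_part_error[OF M mono L pq of_nat_0_le_iff h_def, folded \<kappa>_def] by blast
    \<comment> \<open>The splitting for the parameter \<open>c * r\<close> has an error of at most \<open>C' / (c * r) \<le> 1 / r\<close>.\<close>
    define c where "c = max 1 C'"
    show "\<exists>q\<ge>1. \<forall>k\<ge>1. \<exists>n\<ge>1. \<exists>C>0. \<forall>r>0. ?B q \<subseteq>
        pointwise_scale (C * r ^ n) ` ?B k + pointwise_scale (1 / r) ` ?B p"
    proof (rule exI[of _ q], intro conjI allI impI)
      fix k :: nat assume k: "1 \<le> k"
      have growth: "\<exists>n\<ge>1. \<exists>C>0. \<forall>r\<ge>1. \<forall>X f z. continuous_on UNIV f \<longrightarrow>
          (\<forall>w. \<bar>Im w\<bar> \<le> h \<longrightarrow> norm (f w) \<le> exp (- a q * M (Re w))) \<longrightarrow> 0 \<le> X \<longrightarrow>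
          M X = M 0 + \<kappa> * ln r \<longrightarrow> \<bar>Im z\<bar> < real j \<longrightarrow>
          exp (a j * M (Re z)) * norm (entire_part h (2 * ln r) X f z) \<le> C * r ^ n" for j
        by (rule entire_part_growth[OF M mono L]) (auto simp: h_def)
      obtain n C where n: "1 \<le> n" and C: "0 < C"
        and growth_k: "\<forall>r\<ge>1. \<forall>X f z. continuous_on UNIV f \<longrightarrow>
          (\<forall>w. \<bar>Im w\<bar> \<le> h \<longrightarrow> norm (f w) \<le> exp (- a q * M (Re w))) \<longrightarrow> 0 \<le> X \<longrightarrow>
          M X = M 0 + \<kappa> * ln r \<longrightarrow> \<bar>Im z\<bar> < real k \<longrightarrow>
          exp (a k * M (Re z)) * norm (entire_part h (2 * ln r) X f z) \<le> C * r ^ n"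
        using growth[of k] by (elim exE conjE)
      show "\<exists>n\<ge>1. \<exists>C>0. \<forall>r>0. ?B q \<subseteq>
          pointwise_scale (C * r ^ n) ` ?B k + pointwise_scale (1 / r) ` ?B p"
      proof (intro exI[of _ n] exI[of _ "C * c ^ n"] conjI allI impI subsetI)
        fix r :: real and f assume r: "0 < r" and f: "f \<in> ?B q"
        have fV: "f \<in> ?V" using f by (simp add: seminorm_ball_def)
        have hol: "f holomorphic_on UNIV" using fV by (simp add: OV_def)
        have cont: "continuous_on UNIV f" by (rule holomorphic_on_imp_continuous_on[OF hol])
        have bound_q: "norm (f z) \<le> exp (- a q * M (Re z))" if "\<bar>Im z\<bar> < real q" for z
          using OV_ball_bound[OF f, of z] that
          by (simp add: q_def strip_def \<nu> exp_minus field_simps)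
        have fb: "norm (f w) \<le> exp (- a q * M (Re w))" if "\<bar>Im w\<bar> \<le> h" for w
          using that by (intro bound_q) (simp add: h_def q_def)
        have pos: "0 < C * c ^ n * r ^ n" using C r by (simp add: c_def)
        have "\<exists>f1 f2. f = (\<lambda>z. f1 z + f2 z) \<and> f1 \<in> ?V \<and> f2 \<in> ?V \<and>
            (\<forall>z\<in>strip k. norm (f1 z) * \<nu> k z \<le> C * c ^ n * r ^ n) \<and>
            (\<forall>z\<in>strip p. norm (f2 z) * \<nu> p z \<le> 1 / r)"
        \<comment> \<open>For \<open>r \<le> 1\<close> the function itself is small enough; then the entire part is \<open>0\<close>.\<close>
        proof (cases "r \<le> 1")
          case True
          have "norm (f z) * \<nu> p z \<le> 1 / r" if "z \<in> strip p" for z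
          proof -
            have "norm (f z) * \<nu> p z \<le> exp (- a q * M (Re z)) * exp (a p * M (Re z))"
              unfolding \<nu> using that by (intro mult_right_mono bound_q) (auto simp: strip_def q_def)
            also have "\<dots> = exp (- ((a q - a p) * M (Re z)))"
              by (simp add: exp_add[symmetric] algebra_simps)
            also have "\<dots> \<le> 1" using pq M[of "Re z"] by simp
            also have "1 \<le> 1 / r" using True r by simp
            finally show ?thesis .
          qed
          moreover have "(\<lambda>z. 0) \<in> ?V" by (auto simp: OV_def)
          ultimately show ?thesis
            using fV pos by (intro exI[of _ "\<lambda>z. 0"] exI[of _ f]) auto
        next
          case False
          define s where "s = c * r"
          have s: "1 \<le> s" "C' / s \<le> 1 / r"
          proof -
            show "1 \<le> s" using mult_mono[of 1 c 1 r] False by (simp add: s_def c_def)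
            have "C' / s \<le> c / s" using r by (intro divide_right_mono) (auto simp: s_def c_def)
            also have "\<dots> = 1 / r" by (simp add: s_def c_def)
            finally show "C' / s \<le> 1 / r" .
          qed
          have "\<mu> 0 \<le> M 0 + \<kappa> * ln s" using \<kappa> s(1) by (simp add: M_def)
          then obtain X where X: "0 \<le> X" "M X = M 0 + \<kappa> * ln s"
            using strong_weight_generator_attains[OF assms(1)] unfolding M_def by blast
          define f1 where "f1 = entire_part h (2 * ln s) X f"
          have f1V: "f1 \<in> ?V"
          proof -
            have "bdd_above ((\<lambda>z. norm (f1 z) * \<nu> j z) ` strip j)" for j
            proof -
              obtain m B where growth_j: "\<forall>r\<ge>1. \<forall>X f z. continuous_on UNIV f \<longrightarrow>
                  (\<forall>w. \<bar>Im w\<bar> \<le> h \<longrightarrow> norm (f w) \<le> exp (- a q * M (Re w))) \<longrightarrow> 0 \<le> X \<longrightarrow>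
                  M X = M 0 + \<kappa> * ln r \<longrightarrow> \<bar>Im z\<bar> < real j \<longrightarrow>
                  exp (a j * M (Re z)) * norm (entire_part h (2 * ln r) X f z) \<le> B * r ^ m"
                using growth[of j] by (elim exE conjE)
              have "exp (a j * M (Re z)) * norm (f1 z) \<le> B * s ^ m" if "\<bar>Im z\<bar> < real j" for z
                using growth_j[rule_format, OF s(1) cont fb X that] unfolding f1_def .
              then show ?thesis
                by (intro bdd_aboveI2[where M = "B * s ^ m"]) (simp add: strip_def \<nu> mult.commute)
            qed
            then show ?thesis
              using entire_part_holomorphic[OF cont] by (simp add: OV_def f1_def)
          qed
          have "norm (f1 z) * \<nu> k z \<le> C * c ^ n * r ^ n" if "z \<in> strip k" for z
            using growth_k[rule_format, OF s(1) cont fb X, of z] that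
            by (simp add: f1_def s_def strip_def \<nu> mult_ac power_mult_distrib)
          moreover have "norm (f z - f1 z) * \<nu> p z \<le> 1 / r" if "z \<in> strip p" for z
            using error[rule_format, OF s(1) hol fb X, of z] s(2) that
            by (simp add: f1_def strip_def \<nu> mult.commute)
          moreover have "(\<lambda>z. f z - f1 z) \<in> ?V"
            by (intro OV_diff fV f1V) (simp add: \<nu>)
          ultimately show ?thesis
            using f1V by (intro exI[of _ f1] exI[of _ "\<lambda>z. f z - f1 z"]) auto
        qed
        then obtain f1 f2 where f12: "f = f1 + f2" "f1 \<in> ?V" "f2 \<in> ?V"
            "\<And>z. z \<in> strip k \<Longrightarrow> norm (f1 z) * \<nu> k z \<le> C * c ^ n * r ^ n"
            "\<And>z. z \<in> strip p \<Longrightarrow> norm (f2 z) * \<nu> p z \<le> 1 / r"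
          unfolding plus_fun_def by blast
        show "f \<in> pointwise_scale (C * c ^ n * r ^ n) ` ?B k + pointwise_scale (1 / r) ` ?B p"
          unfolding f12(1) using f12 pos r k p
          by (intro set_plus_intro scaled_ballI strip) auto
      qed (use n C in \<open>auto simp: c_def\<close>)
    qed (simp add: q_def)
  qed
qed

end
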